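(* Suppose $\mathcal{F}_1$ and $\mathcal{F}_2$ are two closed convex parameter spaces with $\mathcal{F}_1\cap\mathcal{F}_2\ne\varnothing$ and $\omega(\varepsilon,\mathcal{F}_1)\le\omega(\varepsilon,\mathcal{F}_2)$ for all $\varepsilon>0$, and let $T$ be a linear functional. Let $\hat T=I_n\hat T_1+(1-I_n)\hat T_2^*$ be the estimator constructed in the context. Then for some fixed $C>0$ (not depending on $n$), $$\sup_{f\in\mathcal{F}_1}E(\hat T-Tf)^2\le C\,\omega^2\!\left(\tfrac1{\sqrt n},\mathcal{F}_1\right)$$ and $$\sup_{f\in\mathcal{F}_2}E(\hat T-Tf)^2\le C\left\{\omega_+^2\!\left(\sqrt{\tfrac{\ln\gamma_+}{n}},\mathcal{F}_1,\mathcal{F}_2\right)+\omega^2\!\left(\tfrac1{\sqrt n},\mathcal{F}_2\right)\right\},$$ where $$\gamma_+=\max\left(e,\frac{\omega_+(1/\sqrt n,\mathcal{F}_1,\mathcal{F}_2)}{\omega(1/\sqrt n,\mathcal{F}_1)}\right).$$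
   Context: White noise model: one observes $dY(t)=f(t)\,dt+\frac{1}{\sqrt n}\,dW(t)$, $-\frac12\le t\le\frac12$, where $W$ is a standard Brownian motion and $f\in L^2[-\frac12,\frac12]$ is unknown. Expectations and probabilities are taken under the true $f$. Parameter spaces are subsets of $L^2[-\frac12,\frac12]$; $T$ is a linear functional (not necessarily $L^2$-continuous) defined on the functions considered. A linear estimator is one of the form $a+\int k(t)\,dY(t)$ with $a\in\mathbb{R}$, $k\in L^2$ (a constant term is allowed). Moduli: $\omega(\varepsilon,\mathcal{F},\mathcal{H})=\sup\{Tg-Tf:\|g-f\|_2\le\varepsilon,\ f\in\mathcal{F},\ g\in\mathcal{H}\}$ (ordered modulus); $\omega_+(\varepsilon,\mathcal{F},\mathcal{H})=\sup\{|Tg-Tf|:\|g-f\|_2\le\varepsilon,\ f\in\mathcal{F},\ g\in\mathcal{H}\}$; $\omega(\varepsilon,\mathcal{F})=\omega(\varepsilon,\mathcal{F},\mathcal{F})$ for any set $\mathcal{F}$ (convex or not). Construction of $\hat T$. Put $\mathcal{G}=\mathcal{F}_1\cup\mathcal{F}_2$. (i) $\hat T_1$ is a linear estimator with $\sup_{f\in\mathcal{F}_1}E(\hat T_1-Tf)^2\le\omega^2(\frac1{\sqrt n},\mathcal{F}_1)$. (ii) $\hat T_2^*$ is an estimator with $\sup_{f\in\mathcal{G}}E(\hat T_2^*-Tf)^4\le C'\omega^4(\frac1{\sqrt n},\mathcal{G})$ for a constant $C'$ not depending on $n$. (iii) For $1\le i\ne j\le2$ let $\gamma_{i,j}=\max\left(e,\frac{\omega(1/\sqrt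 n,\mathcal{F}_i,\mathcal{F}_j)}{\omega(1/\sqrt n,\mathcal{F}_1)}\right)$ and $\sigma_{i,j}^2=\frac1{\ln\gamma_{i,j}}\omega^2\left(\sqrt{\frac{\ln\gamma_{i,j}}n},\mathcal{F}_i,\mathcal{F}_j\right)$. $\hat T_{i,j}$ is a linear estimator such that, with $V=\sigma_{i,j}^2$, $\mathrm{Var}(\hat T_{i,j})\le V$, $\sup_{f\in\mathcal{F}_i}(E\hat T_{i,j}-Tf)\le\frac12\sup_{\varepsilon>0}(\omega(\varepsilon,\mathcal{F}_i,\mathcal{F}_j)-\sqrt{nV}\,\varepsilon)$, $\inf_{f\in\mathcal{F}_j}(E\hat T_{i,j}-Tf)\ge-\frac12\sup_{\varepsilon>0}(\omega(\varepsilon,\mathcal{F}_i,\mathcal{F}_j)-\sqrt{nV}\,\varepsilon)$. (iv) Let $b_{1,2}=\omega(\frac1{\sqrt n},\mathcal{F}_1)+\omega\left(\sqrt{\frac{\ln\gamma_{1,2}}n},\mathcal{F}_1,\mathcal{F}_2\right)$ and $b_{2,1}=\omega(\frac1{\sqrt n},\mathcal{F}_1)+\omega\left(\sqrt{\frac{\ln\gamma_{2,1}}n},\mathcal{F}_2,\mathcal{F}_1\right)$, and let $I_n$ be the indicator of the event $$\hat T_{1,2}-5b_{1,2}-4\omega\left(\tfrac1{\sqrt n},\mathcal{G}\right)\le\hat T_1\le\hat T_{2,1}+5b_{2,1}+4\omega\left(\tfrac1{\sqrt n},\mathcal{G}\right).$$ (v) $\hat T=I_n\hat T_1+(1-I_n)\hat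 T_2^*$. (Estimators as in (i)–(iii) are known to exist for closed convex $\mathcal{F}_1,\mathcal{F}_2$ with nonempty intersection.) *)

theory Defs
  imports "HOL-Probability.Probability"
begin

section \<open>The space $L^2[-1/2,1/2]$\<close>

text \<open>
  Elements of $L^2$ are represented by functions on the line, of which only the restriction to
  \<open>unit_iv\<close> matters. \<open>norm2\<close> is the $L^2$ seminorm on representatives; sets that are
  \<open>closed_L2\<close> are automatically saturated under equality almost everywhere.
\<close>

definition unit_iv :: "real set" where
  "unit_iv = {-1/2..1/2}"

definition L2 :: "(real \<Rightarrow> real) set" where
  "L2 = {f. f \<in> borel_measurable (lebesgue_on unit_iv) \<and>
            integrable (lebesgue_on unit_iv) (\<lambda>t. (f t)\<^sup>2)}"

definition norm2 :: "(real \<Rightarrow> real) \<Rightarrow> real" where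
  "norm2 f = sqrt (LINT t|lebesgue_on unit_iv. (f t)\<^sup>2)"

definition convex_fun_set :: "(real \<Rightarrow> real) set \<Rightarrow> bool" where
  "convex_fun_set F \<longleftrightarrow>
     (\<forall>f\<in>F. \<forall>g\<in>F. \<forall>u. 0 \<le> u \<and> u \<le> 1 \<longrightarrow> (\<lambda>t. (1 - u) * f t + u * g t) \<in> F)"

definition closed_L2 :: "(real \<Rightarrow> real) set \<Rightarrow> bool" where
  "closed_L2 F \<longleftrightarrow> F \<subseteq> L2 \<and>
     (\<forall>h f. (\<forall>j::nat. h j \<in> F) \<and> f \<in> L2 \<and> (\<lambda>j. norm2 (\<lambda>t. h j t - f t)) \<longlonglongrightarrow> 0
            \<longrightarrow> f \<in> F)"

text \<open>
  A linear functional on a linear subspace \<open>D\<close> of $L^2$, not required to be continuous. The last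
  clause says that it is well defined on classes modulo equality almost everywhere.
\<close>

definition linear_functional_on ::
    "(real \<Rightarrow> real) set \<Rightarrow> ((real \<Rightarrow> real) \<Rightarrow> real) \<Rightarrow> bool" where
  "linear_functional_on D T \<longleftrightarrow> D \<subseteq> L2 \<and>
     (\<forall>f\<in>D. \<forall>g\<in>D. \<forall>a b.
        (\<lambda>t. a * f t + b * g t) \<in> D \<and> T (\<lambda>t. a * f t + b * g t) = a * T f + b * T g) \<and>
     (\<forall>f\<in>D. \<forall>g\<in>D. (AE t in lebesgue_on unit_iv. f t = g t) \<longrightarrow> T f = T g)"


section \<open>The white noise model\<close>

text \<open>
  Standard Brownian motion indexed by $[-1/2,1/2]$, started from 0 at the left end point.
\<close>

locale brownian_motion = prob_space M for M :: "'w measure" +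
  fixes W :: "real \<Rightarrow> 'w \<Rightarrow> real"
  assumes W_measurable: "\<And>t. t \<in> unit_iv \<Longrightarrow> W t \<in> borel_measurable M"
    and W_start: "AE x in M. W (-1/2) x = 0"
    and W_continuous: "AE x in M. continuous_on unit_iv (\<lambda>t. W t x)"
    and W_increments: "\<And>s t. s \<in> unit_iv \<Longrightarrow> t \<in> unit_iv \<Longrightarrow> s < t \<Longrightarrow>
          distributed M lborel (\<lambda>x. W t x - W s x) (normal_density 0 (sqrt (t - s)))"
    and W_indep_increments: "\<And>(t :: nat \<Rightarrow> real) m.
          (\<And>i. i \<le> m \<Longrightarrow> t i \<in> unit_iv) \<Longrightarrow> (\<And>i. i < m \<Longrightarrow> t i \<le> t (Suc i)) \<Longrightarrow>
          indep_vars (\<lambda>_. borel) (\<lambda>i x. W (t (Suc i)) x - W (t i) x) {..<m}"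

text \<open>The observed path under \<open>f\<close>, with $Y(-1/2) = 0$.\<close>

definition obs :: "(real \<Rightarrow> 'w \<Rightarrow> real) \<Rightarrow> nat \<Rightarrow> (real \<Rightarrow> real) \<Rightarrow> 'w \<Rightarrow> real \<Rightarrow> real" where
  "obs W n f x = (\<lambda>t\<in>unit_iv. (LINT s|lebesgue_on {-1/2..t}. f s) + 1 / sqrt (real n) * W t x)"

definition estimator :: "((real \<Rightarrow> real) \<Rightarrow> real) \<Rightarrow> bool" where
  "estimator \<delta> \<longleftrightarrow> \<delta> \<in> borel_measurable (Pi\<^sub>M unit_iv (\<lambda>_. borel))"

text \<open>
  \<open>X\<close> is (a version of) the stochastic integral $\int k(t)\,dZ(t)$ of a deterministic
  $k \in L^2$: the limit in mean square of the elementary integrals of step functions that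
  converge to \<open>k\<close> in $L^2$.
\<close>

definition step_fun :: "nat \<Rightarrow> (nat \<Rightarrow> real) \<Rightarrow> (nat \<Rightarrow> real) \<Rightarrow> real \<Rightarrow> real" where
  "step_fun m t c = (\<lambda>s. \<Sum>i<m. c i * indicator {t i<..t (Suc i)} s)"

definition step_integral ::
    "nat \<Rightarrow> (nat \<Rightarrow> real) \<Rightarrow> (nat \<Rightarrow> real) \<Rightarrow> (real \<Rightarrow> real) \<Rightarrow> real" where
  "step_integral m t c z = (\<Sum>i<m. c i * (z (t (Suc i)) - z (t i)))"

definition is_stoch_integral ::
    "'w measure \<Rightarrow> ('w \<Rightarrow> real \<Rightarrow> real) \<Rightarrow> (real \<Rightarrow> real) \<Rightarrow> ('w \<Rightarrow> real) \<Rightarrow> bool" where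
  "is_stoch_integral M Z k X \<longleftrightarrow> k \<in> L2 \<and> X \<in> borel_measurable M \<and>
     (\<exists>m t c.
        (\<forall>j::nat. (\<forall>i\<le>m j. t j i \<in> unit_iv) \<and> (\<forall>i<m j. t j i \<le> t j (Suc i))) \<and>
        (\<lambda>j. norm2 (\<lambda>s. step_fun (m j) (t j) (c j) s - k s)) \<longlonglongrightarrow> 0 \<and>
        (\<lambda>j. \<integral>\<^sup>+x. ennreal ((step_integral (m j) (t j) (c j) (Z x) - X x)\<^sup>2) \<partial>M) \<longlonglongrightarrow> 0)"

text \<open>$\delta(Y) = a + \int k\,dY$, whatever the true \<open>f\<close>.\<close>

definition linear_estimator ::
    "'w measure \<Rightarrow> (real \<Rightarrow> 'w \<Rightarrow> real) \<Rightarrow> nat \<Rightarrow> ((real \<Rightarrow> real) \<Rightarrow> real) \<Rightarrow> bool" where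
  "linear_estimator M W n \<delta> \<longleftrightarrow> estimator \<delta> \<and>
     (\<exists>a. \<exists>k\<in>L2. \<forall>f\<in>L2. is_stoch_integral M (obs W n f) k (\<lambda>x. \<delta> (obs W n f x) - a))"

text \<open>$E_f(\delta - \theta)^p$ for even \<open>p\<close>, possibly infinite.\<close>

definition risk ::
    "'w measure \<Rightarrow> (real \<Rightarrow> 'w \<Rightarrow> real) \<Rightarrow> nat \<Rightarrow> nat \<Rightarrow> ((real \<Rightarrow> real) \<Rightarrow> real) \<Rightarrow>
     (real \<Rightarrow> real) \<Rightarrow> real \<Rightarrow> ereal" where
  "risk M W n p \<delta> f \<theta> = enn2ereal (\<integral>\<^sup>+x. ennreal ((\<delta> (obs W n f x) - \<theta>) ^ p) \<partial>M)"

definition mean_est ::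
    "'w measure \<Rightarrow> (real \<Rightarrow> 'w \<Rightarrow> real) \<Rightarrow> nat \<Rightarrow> ((real \<Rightarrow> real) \<Rightarrow> real) \<Rightarrow>
     (real \<Rightarrow> real) \<Rightarrow> real" where
  "mean_est M W n \<delta> f = prob_space.expectation M (\<lambda>x. \<delta> (obs W n f x))"

definition var_est ::
    "'w measure \<Rightarrow> (real \<Rightarrow> 'w \<Rightarrow> real) \<Rightarrow> nat \<Rightarrow> ((real \<Rightarrow> real) \<Rightarrow> real) \<Rightarrow>
     (real \<Rightarrow> real) \<Rightarrow> real" where
  "var_est M W n \<delta> f = prob_space.variance M (\<lambda>x. \<delta> (obs W n f x))"


section \<open>Moduli of continuity\<close>

text \<open>
  The moduli may be infinite, so they take values in the extended reals; the radius is extended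
  too, since it is $\sqrt{\ln\gamma/n}$ for a ratio \<open>\<gamma>\<close> of moduli. In the degenerate cases the
  conventions of \<^typ>\<open>ereal\<close> apply: $x/0 = \infty$ for $x > 0$, $0/0 = 0$, $x/\infty = 0$,
  $0 \cdot \infty = 0$, $\infty - \infty = \infty$.
\<close>

definition omega ::
    "((real \<Rightarrow> real) \<Rightarrow> real) \<Rightarrow> ereal \<Rightarrow> (real \<Rightarrow> real) set \<Rightarrow> (real \<Rightarrow> real) set \<Rightarrow> ereal" where
  "omega T \<epsilon> F H =
     Sup {ereal (T g - T f) |f g. f \<in> F \<and> g \<in> H \<and> ereal (norm2 (\<lambda>t. g t - f t)) \<le> \<epsilon>}"

definition omega_plus ::
    "((real \<Rightarrow> real) \<Rightarrow> real) \<Rightarrow> ereal \<Rightarrow> (real \<Rightarrow> real) set \<Rightarrow> (real \<Rightarrow> real) set \<Rightarrow> ereal" where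
  "omega_plus T \<epsilon> F H =
     Sup {ereal \<bar>T g - T f\<bar> |f g. f \<in> F \<and> g \<in> H \<and> ereal (norm2 (\<lambda>t. g t - f t)) \<le> \<epsilon>}"

abbreviation omega1 ::
    "((real \<Rightarrow> real) \<Rightarrow> real) \<Rightarrow> ereal \<Rightarrow> (real \<Rightarrow> real) set \<Rightarrow> ereal" where
  "omega1 T \<epsilon> F \<equiv> omega T \<epsilon> F F"

fun ln_ereal :: "ereal \<Rightarrow> ereal" where
  "ln_ereal (ereal r) = (if r > 0 then ereal (ln r) else -\<infinity>)"
| "ln_ereal PInfty = \<infinity>"
| "ln_ereal MInfty = -\<infinity>"

fun sqrt_ereal :: "ereal \<Rightarrow> ereal" where
  "sqrt_ereal (ereal r) = ereal (sqrt r)"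
| "sqrt_ereal PInfty = \<infinity>"
| "sqrt_ereal MInfty = -\<infinity>"

abbreviation noise :: "nat \<Rightarrow> ereal" where
  "noise n \<equiv> ereal (1 / sqrt (real n))"

definition log_radius :: "nat \<Rightarrow> ereal \<Rightarrow> ereal" where
  "log_radius n \<gamma> = sqrt_ereal (ln_ereal \<gamma> / ereal (real n))"


section \<open>The adaptive estimator\<close>

definition gam ::
    "((real \<Rightarrow> real) \<Rightarrow> real) \<Rightarrow> nat \<Rightarrow> (real \<Rightarrow> real) set \<Rightarrow>
     (real \<Rightarrow> real) set \<Rightarrow> (real \<Rightarrow> real) set \<Rightarrow> ereal" where
  "gam T n F1 Fi Fj = max (ereal (exp 1)) (omega T (noise n) Fi Fj / omega1 T (noise n) F1)"

definition gam_plus ::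
    "((real \<Rightarrow> real) \<Rightarrow> real) \<Rightarrow> nat \<Rightarrow> (real \<Rightarrow> real) set \<Rightarrow> (real \<Rightarrow> real) set \<Rightarrow> ereal" where
  "gam_plus T n F1 F2 =
     max (ereal (exp 1)) (omega_plus T (noise n) F1 F2 / omega1 T (noise n) F1)"

definition sigma_sq ::
    "((real \<Rightarrow> real) \<Rightarrow> real) \<Rightarrow> nat \<Rightarrow> (real \<Rightarrow> real) set \<Rightarrow>
     (real \<Rightarrow> real) set \<Rightarrow> (real \<Rightarrow> real) set \<Rightarrow> ereal" where
  "sigma_sq T n F1 Fi Fj =
     1 / ln_ereal (gam T n F1 Fi Fj) * (omega T (log_radius n (gam T n F1 Fi Fj)) Fi Fj)\<^sup>2"

definition bdev ::
    "((real \<Rightarrow> real) \<Rightarrow> real) \<Rightarrow> nat \<Rightarrow> (real \<Rightarrow> real) set \<Rightarrow>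
     (real \<Rightarrow> real) set \<Rightarrow> (real \<Rightarrow> real) set \<Rightarrow> ereal" where
  "bdev T n F1 Fi Fj =
     omega1 T (noise n) F1 + omega T (log_radius n (gam T n F1 Fi Fj)) Fi Fj"

definition bias_bound ::
    "((real \<Rightarrow> real) \<Rightarrow> real) \<Rightarrow> nat \<Rightarrow> ereal \<Rightarrow>
     (real \<Rightarrow> real) set \<Rightarrow> (real \<Rightarrow> real) set \<Rightarrow> ereal" where
  "bias_bound T n V Fi Fj =
     ereal (1/2) *
       (SUP \<epsilon>\<in>{0::real<..}. omega T (ereal \<epsilon>) Fi Fj - sqrt_ereal (ereal (real n) * V) * ereal \<epsilon>)"

text \<open>
  The variance of a linear estimator does not depend on the true function, so the quantifier
  over \<open>f\<close> in the variance bound is only a way to spell it out.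
\<close>

definition bias_variance_estimator ::
    "'w measure \<Rightarrow> (real \<Rightarrow> 'w \<Rightarrow> real) \<Rightarrow> nat \<Rightarrow> ((real \<Rightarrow> real) \<Rightarrow> real) \<Rightarrow> ereal \<Rightarrow>
     (real \<Rightarrow> real) set \<Rightarrow> (real \<Rightarrow> real) set \<Rightarrow> ((real \<Rightarrow> real) \<Rightarrow> real) \<Rightarrow> bool" where
  "bias_variance_estimator M W n T V Fi Fj \<delta> \<longleftrightarrow>
     linear_estimator M W n \<delta> \<and>
     (\<forall>f\<in>L2. ereal (var_est M W n \<delta> f) \<le> V) \<and>
     (SUP f\<in>Fi. ereal (mean_est M W n \<delta> f - T f)) \<le> bias_bound T n V Fi Fj \<and>
     (INF f\<in>Fj. ereal (mean_est M W n \<delta> f - T f)) \<ge> - bias_bound T n V Fi Fj"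

text \<open>
  \<open>accept\<close> is the event whose indicator is $I_n$. The comparison is made in the extended reals:
  a constraint whose bound is infinite is void.
\<close>

definition accept ::
    "((real \<Rightarrow> real) \<Rightarrow> real) \<Rightarrow> nat \<Rightarrow> (real \<Rightarrow> real) set \<Rightarrow> (real \<Rightarrow> real) set \<Rightarrow>
     ((real \<Rightarrow> real) \<Rightarrow> real) \<Rightarrow> ((real \<Rightarrow> real) \<Rightarrow> real) \<Rightarrow> ((real \<Rightarrow> real) \<Rightarrow> real) \<Rightarrow>
     (real \<Rightarrow> real) \<Rightarrow> bool" where
  "accept T n F1 F2 \<delta>1 \<delta>12 \<delta>21 y \<longleftrightarrow>
     ereal (\<delta>12 y) - 5 * bdev T n F1 F1 F2 - 4 * omega1 T (noise n) (F1 \<union> F2) \<le> ereal (\<delta>1 y) \<and>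
     ereal (\<delta>1 y) \<le> ereal (\<delta>21 y) + 5 * bdev T n F1 F2 F1 + 4 * omega1 T (noise n) (F1 \<union> F2)"

definition adaptive_est ::
    "((real \<Rightarrow> real) \<Rightarrow> real) \<Rightarrow> nat \<Rightarrow> (real \<Rightarrow> real) set \<Rightarrow> (real \<Rightarrow> real) set \<Rightarrow>
     ((real \<Rightarrow> real) \<Rightarrow> real) \<Rightarrow> ((real \<Rightarrow> real) \<Rightarrow> real) \<Rightarrow> ((real \<Rightarrow> real) \<Rightarrow> real) \<Rightarrow>
     ((real \<Rightarrow> real) \<Rightarrow> real) \<Rightarrow> (real \<Rightarrow> real) \<Rightarrow> real" where
  "adaptive_est T n F1 F2 \<delta>1 \<delta>2 \<delta>12 \<delta>21 y =
     (let I = of_bool (accept T n F1 F2 \<delta>1 \<delta>12 \<delta>21 y) in I * \<delta>1 y + (1 - I) * \<delta>2 y)"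

end

theory Submission
  imports Defs
begin

text \<open>
  A linear estimator is an $L^2$ limit of Gaussian variables, so by Fatou's lemma its moment
  generating function obeys the Gaussian bound, and with it the Gaussian tail bound. Since
  $\varepsilon \mapsto \omega(\varepsilon)/\varepsilon$ is nonincreasing, the bias of
  $\hat T_{i,j}$ is at most half of $w = \omega(\sqrt{\ln\gamma/n})$ and its variance is at most
  $w^2/\ln\gamma \le \omega^2(1/\sqrt n)$.

  Under $f \in F_1$, a rejection forces one of $\hat T_{1,2}$, $\hat T_{2,1}$, $\hat T_1$ to deviate
  by $4w + 2g$, where $g = \omega(1/\sqrt n, F_1 \cup F_2)$. The part $4w$ contributes a factor
  $\gamma^{-8}$ to the tail bound and the part $2g$ a factor (variance)$^2/g^4$; together the
  rejection probability is at most $4\,\omega^4(1/\sqrt n, F_1)/g^4$, which compensates the fourth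
  moment of $\hat T_2^*$. Under $f \in F_2$, acceptance traps $\hat T_1$ between $\hat T_{1,2}$ and
  $\hat T_{2,1}$ up to the allowed slack, and these have controlled bias on that side.
\<close>

section \<open>Gaussian moment generating functions\<close>

text \<open>Sub-Gaussianity with the variance itself as proxy. An inequality is asked for rather
  than a normal law, so that constants qualify and Fatou's lemma preserves the property in
  mean-square limits; the nonnegative integral makes it meaningful before the exponential is known
  to be integrable.\<close>

definition (in prob_space) gaussian_mgf :: "('a \<Rightarrow> real) \<Rightarrow> bool" where
  "gaussian_mgf X \<longleftrightarrow> X \<in> borel_measurable M \<and> integrable M (\<lambda>x. (X x)\<^sup>2) \<and>
     (\<forall>l. (\<integral>\<^sup>+x. ennreal (exp (l * (X x - expectation X))) \<partial>M)
            \<le> ennreal (exp (l\<^sup>2 * variance X / 2)))"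

context prob_space
begin

lemma gaussian_mgfD:
  assumes "gaussian_mgf X"
  shows "X \<in> borel_measurable M" "integrable M (\<lambda>x. (X x)\<^sup>2)" "integrable M X"
    "integrable M (\<lambda>x. (X x - c)\<^sup>2)"
    "(\<integral>\<^sup>+x. ennreal (exp (l * (X x - expectation X))) \<partial>M) \<le> ennreal (exp (l\<^sup>2 * variance X / 2))"
proof -
  show m: "X \<in> borel_measurable M" and s: "integrable M (\<lambda>x. (X x)\<^sup>2)"
    and "(\<integral>\<^sup>+x. ennreal (exp (l * (X x - expectation X))) \<partial>M) \<le> ennreal (exp (l\<^sup>2 * variance X / 2))"
    using assms by (auto simp: gaussian_mgf_def)
  show i: "integrable M X" by (rule square_integrable_imp_integrable[OF m s])
  show "integrable M (\<lambda>x. (X x - c)\<^sup>2)"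
    unfolding power2_diff using i s by auto
qed

lemma gaussian_mgf_affine:
  assumes X: "gaussian_mgf X"
  shows "gaussian_mgf (\<lambda>x. a + b * X x)"
    "expectation (\<lambda>x. a + b * X x) = a + b * expectation X"
    "variance (\<lambda>x. a + b * X x) = b\<^sup>2 * variance X"
proof -
  note [measurable, simp] = gaussian_mgfD(1,3)[OF X]
  show e: "expectation (\<lambda>x. a + b * X x) = a + b * expectation X"
    by (simp add: prob_space)
  have "variance (\<lambda>x. a + b * X x) = expectation (\<lambda>x. b\<^sup>2 * (X x - expectation X)\<^sup>2)"
    unfolding e by (intro Bochner_Integration.integral_cong refl) (simp add: power2_eq_square algebra_simps)
  then show v: "variance (\<lambda>x. a + b * X x) = b\<^sup>2 * variance X"
    by simp
  have i: "integrable M (\<lambda>x. (a + b * X x)\<^sup>2)"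
    unfolding power2_sum power_mult_distrib using gaussian_mgfD(2)[OF X] by auto
  show "gaussian_mgf (\<lambda>x. a + b * X x)"
    unfolding gaussian_mgf_def e v[unfolded e]
  proof (intro conjI allI)
    fix l
    show "(\<integral>\<^sup>+x. ennreal (exp (l * (a + b * X x - (a + b * expectation X)))) \<partial>M)
        \<le> ennreal (exp (l\<^sup>2 * (b\<^sup>2 * variance X) / 2))"
      using gaussian_mgfD(5)[OF X, of "l * b"] by (simp add: algebra_simps power_mult_distrib)
  qed (use i in simp_all)
qed

lemma variance_le_second_moment:
  fixes X :: "'a \<Rightarrow> real"
  assumes "integrable M X" "integrable M (\<lambda>x. (X x)\<^sup>2)"
  shows "variance X \<le> expectation (\<lambda>x. (X x - c)\<^sup>2)"
proof -
  have "expectation (\<lambda>x. (X x - c)\<^sup>2) = variance X + (expectation X - c)\<^sup>2"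
    using assms by (simp add: power2_diff prob_space algebra_simps power2_eq_square[of "expectation X"])
  then show ?thesis by simp
qed

lemma gaussian_mgf_normal:
  assumes D: "distributed M lborel X (normal_density 0 s)" and s[arith]: "0 < s"
  shows "gaussian_mgf X" "expectation X = 0" "variance X = s\<^sup>2"
proof -
  show e: "expectation X = 0" by (rule normal_distributed_expectation[OF s D])
  show v: "variance X = s\<^sup>2" by (rule normal_distributed_variance[OF s D])
  have m: "X \<in> borel_measurable M"
    using distributed_measurable[OF D] by simp
  have "integrable lborel (\<lambda>x. normal_density 0 s x * x\<^sup>2)"
    using integrable_normal_moment[OF s, of 0 2] by simp
  then have sq: "integrable M (\<lambda>x. (X x)\<^sup>2)"
    using distributed_integrable[OF D, of "\<lambda>x. x\<^sup>2"] by simp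
  have "(\<integral>\<^sup>+x. ennreal (exp (l * X x)) \<partial>M) = ennreal (exp (l\<^sup>2 * s\<^sup>2 / 2))" for l
  proof -
    have "(\<integral>\<^sup>+x. ennreal (exp (l * X x)) \<partial>M)
        = (\<integral>\<^sup>+x. ennreal (normal_density 0 s x) * ennreal (exp (l * x)) \<partial>lborel)"
      by (subst distributed_nn_integral[OF D]) auto
    \<comment> \<open>Completing the square: tilting the centred normal density by
      \<open>exp (l * x)\<close> shifts its mean to \<open>l * s\<^sup>2\<close>, and the
      normalizing factor is the moment generating function.\<close>
    also have "\<dots> = (\<integral>\<^sup>+x. ennreal (exp (l\<^sup>2 * s\<^sup>2 / 2)) * ennreal (normal_density (l * s\<^sup>2) s x) \<partial>lborel)"
    proof (intro nn_integral_cong)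
      fix x :: real
      have "- (x\<^sup>2) / (2 * s\<^sup>2) + l * x = l\<^sup>2 * s\<^sup>2 / 2 - (x - l * s\<^sup>2)\<^sup>2 / (2 * s\<^sup>2)"
        using s by (simp add: field_simps power2_eq_square)
      then show "ennreal (normal_density 0 s x) * ennreal (exp (l * x)) =
          ennreal (exp (l\<^sup>2 * s\<^sup>2 / 2)) * ennreal (normal_density (l * s\<^sup>2) s x)"
        by (simp add: normal_density_def ennreal_mult[symmetric] exp_add[symmetric])
    qed
    also have "\<dots> = ennreal (exp (l\<^sup>2 * s\<^sup>2 / 2))"
      by (subst nn_integral_cmult) (auto simp: nn_integral_eq_integral normal_density_nonneg)
    finally show ?thesis .
  qed
  then show "gaussian_mgf X"
    unfolding gaussian_mgf_def e v[unfolded e] using m sq by (simp add: e v[unfolded e])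
qed

lemma gaussian_mgf_const: "gaussian_mgf (\<lambda>x. c)"
  by (simp add: gaussian_mgf_def prob_space emeasure_space_1)

text \<open>Mean-square convergence makes the means converge and bounds the variances asymptotically
  by that of the limit. Along an almost surely convergent subsequence, Fatou's lemma then transfers
  the exponential bound.\<close>

lemma gaussian_mgf_limit:
  assumes G: "\<And>j. gaussian_mgf (Y j)" and X[measurable]: "X \<in> borel_measurable M"
    and lim: "(\<lambda>j. \<integral>\<^sup>+x. ennreal ((Y j x - X x)\<^sup>2) \<partial>M) \<longlonglongrightarrow> 0"
  shows "gaussian_mgf X"
proof -
  note Ym[measurable] = gaussian_mgfD(1)[OF G]
  \<comment> \<open>Finitely many of the mean-square distances may be infinite; shifting the index
    by \<open>j0\<close> discards them.\<close>
  have "eventually (\<lambda>j. (\<integral>\<^sup>+x. ennreal ((Y j x - X x)\<^sup>2) \<partial>M) < \<infinity>) sequentially"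
    using lim by (rule order_tendstoD) simp
  then obtain j0 where j0: "\<And>j. j \<ge> j0 \<Longrightarrow> (\<integral>\<^sup>+x. ennreal ((Y j x - X x)\<^sup>2) \<partial>M) < \<infinity>"
    by (auto simp: eventually_sequentially)
  define Z where "Z j = Y (j + j0)" for j
  note GZ = G[of "_ + j0", folded Z_def]
  have Zm[measurable]: "Z j \<in> borel_measurable M" for j
    unfolding Z_def by simp
  have D2: "integrable M (\<lambda>x. (Z j x - X x)\<^sup>2)" for j
    unfolding Z_def by (intro integrableI_bounded) (use j0 in \<open>auto simp: less_top\<close>)
  have D1: "integrable M (\<lambda>x. Z j x - X x)" for j
    by (rule square_integrable_imp_integrable[OF _ D2]) auto
  define d where "d j = expectation (\<lambda>x. (Z j x - X x)\<^sup>2)" for j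
  have d0: "d \<longlonglongrightarrow> 0"
  proof -
    have "(\<lambda>j. ennreal (d j)) \<longlonglongrightarrow> ennreal 0"
      using LIMSEQ_ignore_initial_segment[OF lim, of j0]
      unfolding d_def by (subst nn_integral_eq_integral[symmetric]) (use D2 in \<open>auto simp: Z_def\<close>)
    then show ?thesis
      by (subst (asm) tendsto_ennreal_iff) (auto simp: d_def)
  qed
  have X1: "integrable M X"
    using Bochner_Integration.integrable_diff[OF gaussian_mgfD(3)[OF GZ] D1, of 0 0] by simp
  have X2: "integrable M (\<lambda>x. (X x)\<^sup>2)"
  proof (rule Bochner_Integration.integrable_bound)
    show "integrable M (\<lambda>x. 2 * (Z 0 x)\<^sup>2 + 2 * (Z 0 x - X x)\<^sup>2)"
      using gaussian_mgfD(2)[OF GZ, of 0] D2[of 0] by simp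
    have "x\<^sup>2 \<le> 2 * z\<^sup>2 + 2 * (z - x)\<^sup>2" for x z :: real
      using zero_le_power2[of "x - 2 * z"] by (simp add: power2_eq_square algebra_simps)
    then show "AE x in M. norm ((X x)\<^sup>2) \<le> norm (2 * (Z 0 x)\<^sup>2 + 2 * (Z 0 x - X x)\<^sup>2)"
      by (auto intro!: AE_I2)
  qed simp
  define \<mu> where "\<mu> = expectation X"
  have Xc: "integrable M (\<lambda>x. (X x - \<mu>)\<^sup>2)"
    unfolding power2_diff using X1 X2 by simp
  define m where "m j = expectation (Z j)" for j
  \<comment> \<open>The squared mean of a difference is at most its second moment, because the
    variance is nonnegative.\<close>
  have "(\<lambda>j. m j - \<mu>) \<longlonglongrightarrow> 0"
  proof (rule tendsto_0_le[where K = 1])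
    show "(\<lambda>j. sqrt (d j)) \<longlonglongrightarrow> 0" using tendsto_real_sqrt[OF d0] by simp
    have "m j - \<mu> = expectation (\<lambda>x. Z j x - X x)" for j
      unfolding m_def \<mu>_def using gaussian_mgfD(3)[OF GZ] X1 by simp
    moreover have "(expectation (\<lambda>x. Z j x - X x))\<^sup>2 \<le> d j" for j
      using variance_positive[of "\<lambda>x. Z j x - X x"] variance_eq[OF D1 D2, of j] by (simp add: d_def)
    ultimately have "\<bar>m j - \<mu>\<bar> \<le> sqrt (d j)" for j
      using real_sqrt_le_mono[of "(m j - \<mu>)\<^sup>2" "d j"] by simp
    then show "\<forall>\<^sub>F j in sequentially. norm (m j - \<mu>) \<le> norm (sqrt (d j)) * 1"
      by (intro always_eventually allI) (metis abs_ge_self mult_1_right order_trans real_norm_def)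
  qed
  then have m: "m \<longlonglongrightarrow> \<mu>" by (rule LIM_zero_cancel)
  \<comment> \<open>Young's inequality with a free weight \<open>a\<close>, obtained from (ap -
    q)^2/a \<ge> 0. The error term vanishes as j grows for fixed \<open>a\<close>, and only
    afterwards does \<open>a\<close> tend to 0.\<close>
  have vle: "variance (Z j) \<le> (1 + a) * variance X + (1 + 1 / a) * d j" if a: "a > 0" for j a
  proof -
    have "variance (Z j) \<le> expectation (\<lambda>x. (Z j x - \<mu>)\<^sup>2)"
      using gaussian_mgfD[OF GZ] by (intro variance_le_second_moment) auto
    also have "\<dots> \<le> expectation (\<lambda>x. (1 + a) * (X x - \<mu>)\<^sup>2 + (1 + 1 / a) * (Z j x - X x)\<^sup>2)"
    proof (rule integral_mono)
      show "integrable M (\<lambda>x. (Z j x - \<mu>)\<^sup>2)" by (rule gaussian_mgfD(4)[OF GZ])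
      show "integrable M (\<lambda>x. (1 + a) * (X x - \<mu>)\<^sup>2 + (1 + 1 / a) * (Z j x - X x)\<^sup>2)"
        using Xc D2 by simp
      fix x
      have "(p + q)\<^sup>2 \<le> (1 + a) * p\<^sup>2 + (1 + 1 / a) * q\<^sup>2" for p q :: real
      proof -
        have "0 \<le> (a * p - q)\<^sup>2 / a" using a by simp
        also have "\<dots> = (1 + a) * p\<^sup>2 + (1 + 1 / a) * q\<^sup>2 - (p + q)\<^sup>2"
          using a by (simp add: field_simps power2_eq_square)
        finally show ?thesis by simp
      qed
      from this[of "X x - \<mu>" "Z j x - X x"]
      show "(Z j x - \<mu>)\<^sup>2 \<le> (1 + a) * (X x - \<mu>)\<^sup>2 + (1 + 1 / a) * (Z j x - X x)\<^sup>2"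
        by simp
    qed
    also have "\<dots> = (1 + a) * variance X + (1 + 1 / a) * d j"
      using Xc D2 by (simp add: d_def \<mu>_def)
    finally show ?thesis .
  qed
  obtain r where r: "strict_mono r" "AE x in M. (\<lambda>j. (Z (r j) x - X x)\<^sup>2) \<longlonglongrightarrow> 0"
    using tendsto_L1_AE_subseq[of M "\<lambda>j x. (Z j x - X x)\<^sup>2", OF D2] d0[unfolded d_def] by auto
  have AE: "AE x in M. (\<lambda>j. Z (r j) x) \<longlonglongrightarrow> X x"
    using r(2)
  proof eventually_elim
    case (elim x)
    then have "(\<lambda>j. sqrt ((Z (r j) x - X x)\<^sup>2)) \<longlonglongrightarrow> sqrt 0" by (intro tendsto_intros)
    then have "(\<lambda>j. Z (r j) x - X x) \<longlonglongrightarrow> 0" by (simp add: tendsto_rabs_zero_iff)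
    then show ?case by (rule LIM_zero_cancel)
  qed
  have mr: "(\<lambda>j. m (r j)) \<longlonglongrightarrow> \<mu>" and dr: "(\<lambda>j. d (r j)) \<longlonglongrightarrow> 0"
    using LIMSEQ_subseq_LIMSEQ[OF m r(1)] LIMSEQ_subseq_LIMSEQ[OF d0 r(1)] by (auto simp: o_def)
  have bound: "(\<integral>\<^sup>+x. ennreal (exp (l * (X x - \<mu>))) \<partial>M) \<le> ennreal (exp (l\<^sup>2 * ((1 + a) * variance X) / 2))"
    if a: "a > 0" for l a
  proof -
    have "(\<integral>\<^sup>+x. ennreal (exp (l * (X x - \<mu>))) \<partial>M)
        = (\<integral>\<^sup>+x. liminf (\<lambda>j. ennreal (exp (l * (Z (r j) x - m (r j))))) \<partial>M)"
    proof (rule nn_integral_cong_AE)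
      show "AE x in M. ennreal (exp (l * (X x - \<mu>))) = liminf (\<lambda>j. ennreal (exp (l * (Z (r j) x - m (r j)))))"
        using AE
      proof eventually_elim
        case (elim x)
        have "(\<lambda>j. ennreal (exp (l * (Z (r j) x - m (r j))))) \<longlonglongrightarrow> ennreal (exp (l * (X x - \<mu>)))"
          by (intro tendsto_intros elim mr)
        then show ?case by (intro lim_imp_Liminf[symmetric]) auto
      qed
    qed
    also have "\<dots> \<le> liminf (\<lambda>j. \<integral>\<^sup>+x. ennreal (exp (l * (Z (r j) x - m (r j)))) \<partial>M)"
      by (rule nn_integral_liminf) simp
    also have "\<dots> \<le> liminf (\<lambda>j. ennreal (exp (l\<^sup>2 * ((1 + a) * variance X + (1 + 1 / a) * d (r j)) / 2)))"
    proof (intro Liminf_mono always_eventually allI)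
      fix j
      have "(\<integral>\<^sup>+x. ennreal (exp (l * (Z (r j) x - m (r j)))) \<partial>M)
          \<le> ennreal (exp (l\<^sup>2 * variance (Z (r j)) / 2))"
        unfolding m_def by (rule gaussian_mgfD(5)[OF GZ])
      also have "\<dots> \<le> ennreal (exp (l\<^sup>2 * ((1 + a) * variance X + (1 + 1 / a) * d (r j)) / 2))"
        using mult_left_mono[OF vle[OF a, of "r j"], of "l\<^sup>2"] by (intro ennreal_leI) simp
      finally show "(\<integral>\<^sup>+x. ennreal (exp (l * (Z (r j) x - m (r j)))) \<partial>M)
          \<le> ennreal (exp (l\<^sup>2 * ((1 + a) * variance X + (1 + 1 / a) * d (r j)) / 2))" .
    qed
    also have "\<dots> = ennreal (exp (l\<^sup>2 * ((1 + a) * variance X + (1 + 1 / a) * 0) / 2))"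
      by (intro lim_imp_Liminf tendsto_intros dr) auto
    finally show ?thesis by simp
  qed
  have "(\<integral>\<^sup>+x. ennreal (exp (l * (X x - \<mu>))) \<partial>M) \<le> ennreal (exp (l\<^sup>2 * variance X / 2))" for l
  proof (rule tendsto_lowerbound)
    show "((\<lambda>a. ennreal (exp (l\<^sup>2 * ((1 + a) * variance X) / 2))) \<longlongrightarrow> ennreal (exp (l\<^sup>2 * variance X / 2)))
        (at_right 0)"
      by (rule tendsto_eq_intros refl | simp)+
    show "\<forall>\<^sub>F a in at_right 0. (\<integral>\<^sup>+x. ennreal (exp (l * (X x - \<mu>))) \<partial>M)
        \<le> ennreal (exp (l\<^sup>2 * ((1 + a) * variance X) / 2))"
      using bound by (auto simp: eventually_at_filter)
  qed simp
  then show ?thesis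
    unfolding gaussian_mgf_def using X2 by (simp add: \<mu>_def)
qed

lemma gaussian_tail:
  assumes G: "gaussian_mgf X" and V: "variance X \<le> V" "0 < V" and y: "0 \<le> y"
  shows "prob {x\<in>space M. y \<le> X x - expectation X} \<le> exp (- y\<^sup>2 / (2 * V))"
proof -
  note [measurable] = gaussian_mgfD(1)[OF G]
  \<comment> \<open>Chernoff's method: this \<open>l\<close> minimizes l^2 V/2 - ly, with minimum
    -y^2/(2V).\<close>
  define l where "l = y / V"
  have l: "l \<ge> 0" using V y by (simp add: l_def)
  have "emeasure M {x\<in>space M. y \<le> X x - expectation X}
      \<le> emeasure M {x\<in>space M. 1 \<le> ennreal (exp (- l * y)) * ennreal (exp (l * (X x - expectation X)))}"
    using l by (intro emeasure_mono)
      (auto simp: ennreal_mult[symmetric] exp_add[symmetric] simp flip: ennreal_1 dest: mult_left_mono[of _ _ l] simp del: ennreal_1)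
  also have "\<dots> \<le> ennreal (exp (- l * y)) * (\<integral>\<^sup>+x. ennreal (exp (l * (X x - expectation X))) * indicator (space M) x \<partial>M)"
    using nn_integral_Markov_inequality[of "\<lambda>x. ennreal (exp (l * (X x - expectation X)))" "space M" M "ennreal (exp (- l * y))"]
    by simp
  also have "\<dots> = ennreal (exp (- l * y)) * (\<integral>\<^sup>+x. ennreal (exp (l * (X x - expectation X))) \<partial>M)"
    by (intro arg_cong2[where f="(*)"] refl nn_integral_cong) auto
  also have "\<dots> \<le> ennreal (exp (- l * y)) * ennreal (exp (l\<^sup>2 * V / 2))"
    using V(1) by (intro mult_left_mono order_trans[OF gaussian_mgfD(5)[OF G]] ennreal_leI) (auto intro: mult_left_mono)
  also have "\<dots> = ennreal (exp (- y\<^sup>2 / (2 * V)))"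
    using V(2) by (auto simp: ennreal_mult[symmetric] exp_add[symmetric] l_def field_simps power2_eq_square)
  finally show ?thesis
    by (simp add: emeasure_eq_measure)
qed

text \<open>Serves the degenerate case left out by \<open>gaussian_tail\<close>, which divides by a
  positive variance bound.\<close>

lemma variance_zero_AE:
  fixes X :: "'a \<Rightarrow> real"
  assumes "integrable M (\<lambda>x. (X x - expectation X)\<^sup>2)" "variance X \<le> 0"
  shows "AE x in M. X x = expectation X"
proof -
  have "variance X = 0" using assms(2) variance_positive[of X] by linarith
  then show ?thesis
    using integral_nonneg_eq_0_iff_AE[OF assms(1)] by simp
qed

end

section \<open>Linear estimators in the white noise model\<close>

context brownian_motion
begin

lemma gaussian_mgf_increments:
  assumes t: "\<And>i. i \<le> m \<Longrightarrow> t i \<in> unit_iv" "\<And>i. i < m \<Longrightarrow> t i \<le> t (Suc i)"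
  shows "gaussian_mgf (\<lambda>x. \<Sum>i<m. c i * (W (t (Suc i)) x - W (t i) x))"
proof -
  \<comment> \<open>Only terms with a nonzero coefficient and a nontrivial time interval have a
    normal density. The others vanish identically, and if none is left the sum is the constant
    0.\<close>
  define J where "J = {i. i < m \<and> c i \<noteq> 0 \<and> t i < t (Suc i)}"
  let ?D = "\<lambda>i x. c i * (W (t (Suc i)) x - W (t i) x)"
  have J: "finite J" "J \<subseteq> {..<m}" by (auto simp: J_def)
  have "?D i x = 0" if "i \<in> {..<m} - J" for i x
    using that t(2)[of i] by (cases "t i = t (Suc i)") (auto simp: J_def)
  then have eq: "(\<lambda>x. \<Sum>i<m. ?D i x) = (\<lambda>x. \<Sum>i\<in>J. ?D i x)"
    using J by (intro ext sum.mono_neutral_right) auto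
  show ?thesis
  proof (cases "J = {}")
    case True
    then show ?thesis unfolding eq using gaussian_mgf_const[of 0] by simp
  next
    case False
    let ?s = "\<lambda>i. \<bar>c i\<bar> * sqrt (t (Suc i) - t i)"
    have s: "0 < ?s i" if "i \<in> J" for i
      using that by (auto simp: J_def)
    have "indep_vars (\<lambda>_. borel) (\<lambda>i x. W (t (Suc i)) x - W (t i) x) J"
      by (rule indep_vars_subset[OF W_indep_increments[of m t, OF t] J(2)])
    then have ind: "indep_vars (\<lambda>_. borel) ?D J"
      by (rule indep_vars_compose2) auto
    have "distributed M lborel (?D i) (normal_density 0 (?s i))" if "i \<in> J" for i
    proof -
      have "distributed M lborel (\<lambda>x. W (t (Suc i)) x - W (t i) x) (normal_density 0 (sqrt (t (Suc i) - t i)))"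
        using that t by (intro W_increments) (auto simp: J_def)
      from normal_density_affine[OF this, of "c i" 0] that show ?thesis
        by (auto simp: J_def)
    qed
    then have "distributed M lborel (\<lambda>x. \<Sum>i\<in>J. ?D i x) (normal_density (\<Sum>i\<in>J. 0) (sqrt (\<Sum>i\<in>J. (?s i)\<^sup>2)))"
      by (intro sum_indep_normal J False ind s)
    moreover have "0 < sqrt (\<Sum>i\<in>J. (?s i)\<^sup>2)"
      by (intro real_sqrt_gt_zero sum_pos J False zero_less_power s)
    ultimately show ?thesis
      unfolding eq sum.neutral_const by (rule gaussian_mgf_normal(1))
  qed
qed

text \<open>An elementary integral of the observed path is a deterministic drift term plus 1/sqrt(n)
  times a weighted sum of Brownian increments. It therefore has the property, which survives the
  mean-square limit.\<close>

lemma gaussian_mgf_stoch_integral: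
  assumes "is_stoch_integral M (obs W n f) k X"
  shows "gaussian_mgf X"
proof -
  obtain m t c where X: "X \<in> borel_measurable M"
    and t: "\<And>j i. i \<le> m j \<Longrightarrow> t j i \<in> unit_iv" "\<And>j i. i < m j \<Longrightarrow> t j i \<le> t j (Suc i)"
    and lim: "(\<lambda>j. \<integral>\<^sup>+x. ennreal ((step_integral (m j) (t j) (c j) (obs W n f x) - X x)\<^sup>2) \<partial>M) \<longlonglongrightarrow> 0"
    using assms unfolding is_stoch_integral_def by blast
  have "gaussian_mgf (\<lambda>x. step_integral (m j) (t j) (c j) (obs W n f x))" for j
  proof -
    let ?I = "\<lambda>t. LINT s|lebesgue_on {-1/2..t}. f s"
    have "step_integral (m j) (t j) (c j) (obs W n f x)
        = (\<Sum>i<m j. c j i * (?I (t j (Suc i)) - ?I (t j i)))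
          + (1 / sqrt (real n)) * (\<Sum>i<m j. c j i * (W (t j (Suc i)) x - W (t j i) x))" for x
      unfolding step_integral_def sum_distrib_left sum.distrib[symmetric]
      by (intro sum.cong refl) (use t(1)[of _ j] in \<open>simp add: obs_def algebra_simps\<close>)
    then show ?thesis
      using gaussian_mgf_affine(1)[OF gaussian_mgf_increments[of "m j" "t j" "c j"]] t by presburger
  qed
  then show ?thesis by (rule gaussian_mgf_limit[OF _ X lim])
qed

lemma gaussian_mgf_linear_estimator:
  assumes "linear_estimator M W n \<delta>" "f \<in> L2"
  shows "gaussian_mgf (\<lambda>x. \<delta> (obs W n f x))"
proof -
  obtain a k where "is_stoch_integral M (obs W n f) k (\<lambda>x. \<delta> (obs W n f x) - a)"
    using assms unfolding linear_estimator_def by blast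
  from gaussian_mgf_affine(1)[OF gaussian_mgf_stoch_integral[OF this], of a 1] show ?thesis by simp
qed

lemma measurable_obs: "obs W n f \<in> M \<rightarrow>\<^sub>M Pi\<^sub>M unit_iv (\<lambda>_. borel)"
  unfolding obs_def using W_measurable by (intro measurable_restrict) auto

lemma measurable_estimator:
  assumes "estimator \<delta>"
  shows "(\<lambda>x. \<delta> (obs W n f x)) \<in> borel_measurable M"
  using measurable_compose[OF measurable_obs] assms unfolding estimator_def by blast

end

section \<open>Moduli of continuity\<close>

lemma norm2_scale: "norm2 (\<lambda>t. a * f t) = \<bar>a\<bar> * norm2 f"
  by (simp add: norm2_def power_mult_distrib real_sqrt_mult)

lemma norm2_diff_commute: "norm2 (\<lambda>t. f t - g t) = norm2 (\<lambda>t. g t - f t)"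
  unfolding norm2_def by (simp only: power2_commute)

lemma norm2_zero: "norm2 (\<lambda>t. 0) = 0"
  by (simp add: norm2_def)

lemma ln_sqrt_ereal_infinity: "ln_ereal \<infinity> = \<infinity>" "sqrt_ereal \<infinity> = \<infinity>"
  using ln_ereal.simps(2) sqrt_ereal.simps(2) unfolding infinity_ereal_def by blast+

lemma omega_upper:
  assumes "f \<in> F" "g \<in> H" "ereal (norm2 (\<lambda>t. g t - f t)) \<le> \<epsilon>"
  shows "ereal (T g - T f) \<le> omega T \<epsilon> F H"
  unfolding omega_def by (rule Sup_upper, rule CollectI, rule exI[of _ f], rule exI[of _ g]) (use assms in simp)

lemma omega_least:
  assumes "\<And>f g. f \<in> F \<Longrightarrow> g \<in> H \<Longrightarrow> ereal (norm2 (\<lambda>t. g t - f t)) \<le> \<epsilon> \<Longrightarrow> ereal (T g - T f) \<le> c"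
  shows "omega T \<epsilon> F H \<le> c"
  unfolding omega_def by (rule Sup_least) (use assms in auto)

lemma omega_plus_upper:
  assumes "f \<in> F" "g \<in> H" "ereal (norm2 (\<lambda>t. g t - f t)) \<le> \<epsilon>"
  shows "ereal \<bar>T g - T f\<bar> \<le> omega_plus T \<epsilon> F H"
  unfolding omega_plus_def by (rule Sup_upper, rule CollectI, rule exI[of _ f], rule exI[of _ g]) (use assms in simp)

lemma omega_plus_least:
  assumes "\<And>f g. f \<in> F \<Longrightarrow> g \<in> H \<Longrightarrow> ereal (norm2 (\<lambda>t. g t - f t)) \<le> \<epsilon> \<Longrightarrow> ereal \<bar>T g - T f\<bar> \<le> c"
  shows "omega_plus T \<epsilon> F H \<le> c"
  unfolding omega_plus_def by (rule Sup_least) (use assms in auto)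

lemma omega_mono:
  assumes "\<epsilon> \<le> \<epsilon>'"
  shows "omega T \<epsilon> F H \<le> omega T \<epsilon>' F H"
proof (rule omega_least)
  fix f g assume "f \<in> F" "g \<in> H" "ereal (norm2 (\<lambda>t. g t - f t)) \<le> \<epsilon>"
  then show "ereal (T g - T f) \<le> omega T \<epsilon>' F H"
    using order_trans[OF _ assms] by (intro omega_upper)
qed

lemma omega_plus_mono:
  assumes "\<epsilon> \<le> \<epsilon>'"
  shows "omega_plus T \<epsilon> F H \<le> omega_plus T \<epsilon>' F H"
proof (rule omega_plus_least)
  fix f g assume "f \<in> F" "g \<in> H" "ereal (norm2 (\<lambda>t. g t - f t)) \<le> \<epsilon>"
  then show "ereal \<bar>T g - T f\<bar> \<le> omega_plus T \<epsilon>' F H"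
    using order_trans[OF _ assms] by (intro omega_plus_upper)
qed

lemma omega_le_omega_plus:
  "omega T \<epsilon> F H \<le> omega_plus T \<epsilon> F H" "omega T \<epsilon> H F \<le> omega_plus T \<epsilon> F H"
proof -
  show "omega T \<epsilon> F H \<le> omega_plus T \<epsilon> F H"
  proof (rule omega_least)
    fix f g assume "f \<in> F" "g \<in> H" "ereal (norm2 (\<lambda>t. g t - f t)) \<le> \<epsilon>"
    from omega_plus_upper[OF this, of T] show "ereal (T g - T f) \<le> omega_plus T \<epsilon> F H"
      by (rule order_trans[rotated]) simp
  qed
  show "omega T \<epsilon> H F \<le> omega_plus T \<epsilon> F H"
  proof (rule omega_least)
    fix f g assume "f \<in> H" "g \<in> F" and *: "ereal (norm2 (\<lambda>t. g t - f t)) \<le> \<epsilon>"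
    have "ereal (T g - T f) \<le> ereal \<bar>T f - T g\<bar>" by simp
    also have "\<dots> \<le> omega_plus T \<epsilon> F H"
      using \<open>f \<in> H\<close> \<open>g \<in> F\<close> * by (intro omega_plus_upper) (simp_all add: norm2_diff_commute[of f g])
    finally show "ereal (T g - T f) \<le> omega_plus T \<epsilon> F H" .
  qed
qed

text \<open>A pair from the union is of one of four kinds; the two mixed kinds are dominated by
  \<open>omega_plus\<close>. This later expresses the accuracy of the fallback estimator through the
  target rate.\<close>

lemma omega_Un_le:
  "omega1 T \<epsilon> (F \<union> H) \<le> max (max (omega1 T \<epsilon> F) (omega1 T \<epsilon> H)) (omega_plus T \<epsilon> F H)"
proof (rule omega_least)
  fix f g assume *: "f \<in> F \<union> H" "g \<in> F \<union> H" "ereal (norm2 (\<lambda>t. g t - f t)) \<le> \<epsilon>"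
  then have "ereal (T g - T f) \<le> omega1 T \<epsilon> F \<or> ereal (T g - T f) \<le> omega1 T \<epsilon> H
      \<or> ereal (T g - T f) \<le> omega T \<epsilon> F H \<or> ereal (T g - T f) \<le> omega T \<epsilon> H F"
    using omega_upper by blast
  then show "ereal (T g - T f) \<le> max (max (omega1 T \<epsilon> F) (omega1 T \<epsilon> H)) (omega_plus T \<epsilon> F H)"
    using omega_le_omega_plus(1)[of T \<epsilon> F H] omega_le_omega_plus(2)[of T \<epsilon> H F]
    by (auto simp: le_max_iff_disj)
qed

lemma omega_mono_sets:
  assumes "F \<subseteq> F'" "H \<subseteq> H'"
  shows "omega T \<epsilon> F H \<le> omega T \<epsilon> F' H'"
proof (rule omega_least)
  fix f g assume "f \<in> F" "g \<in> H" "ereal (norm2 (\<lambda>t. g t - f t)) \<le> \<epsilon>"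
  then show "ereal (T g - T f) \<le> omega T \<epsilon> F' H'"
    using assms by (intro omega_upper) blast+
qed

lemma omega_nonneg:
  assumes "F \<inter> H \<noteq> {}" "0 \<le> \<epsilon>"
  shows "0 \<le> omega T \<epsilon> F H"
proof -
  obtain h where "h \<in> F" "h \<in> H" using assms by blast
  then show ?thesis
    using omega_upper[of h F h H \<epsilon> T] assms(2) by (simp add: norm2_zero zero_ereal_def[symmetric])
qed

text \<open>Contract a pair f, g towards a common point h by the factor 1/c. Convexity keeps the
  images in their sets, while the distance and, by linearity of \<open>T\<close>, the difference of
  values are both divided by c.\<close>

lemma omega_scale:
  assumes T: "linear_functional_on D T" "F \<union> H \<subseteq> D"
    and F: "convex_fun_set F" and H: "convex_fun_set H" and h: "F \<inter> H \<noteq> {}"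
    and c: "1 \<le> c"
  shows "omega T (ereal (c * \<epsilon>)) F H \<le> ereal c * omega T (ereal \<epsilon>) F H"
proof (rule omega_least)
  fix f g assume f: "f \<in> F" and g: "g \<in> H" and le: "ereal (norm2 (\<lambda>t. g t - f t)) \<le> ereal (c * \<epsilon>)"
  obtain h where hF: "h \<in> F" and hH: "h \<in> H" using h by blast
  let ?s = "\<lambda>f t. (1 - 1 / c) * h t + (1 / c) * f t"
  have u: "0 \<le> 1 / c" "1 / c \<le> 1" using c by auto
  have sf: "?s f \<in> F" and sg: "?s g \<in> H"
    using F H f g hF hH u unfolding convex_fun_set_def by blast+
  have T': "T (?s k) = (1 - 1 / c) * T h + (1 / c) * T k" if "k \<in> F \<union> H" for k
    using T that hF unfolding linear_functional_on_def by blast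
  have "(\<lambda>t. ?s g t - ?s f t) = (\<lambda>t. (1 / c) * (g t - f t))"
    by (simp add: algebra_simps)
  then have "norm2 (\<lambda>t. ?s g t - ?s f t) = norm2 (\<lambda>t. g t - f t) / c"
    using c by (simp only: norm2_scale) simp
  then have "ereal (norm2 (\<lambda>t. ?s g t - ?s f t)) \<le> ereal \<epsilon>"
    using le c by (simp add: divide_le_eq mult.commute)
  from omega_upper[OF sf sg this, of T]
  have *: "ereal ((T g - T f) / c) \<le> omega T (ereal \<epsilon>) F H"
    using T'[of f] T'[of g] f g by (simp add: diff_divide_distrib)
  have "ereal (T g - T f) = ereal c * ereal ((T g - T f) / c)"
    using c by simp
  also have "\<dots> \<le> ereal c * omega T (ereal \<epsilon>) F H"
    using c by (intro ereal_mult_left_mono *) auto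
  finally show "ereal (T g - T f) \<le> ereal c * omega T (ereal \<epsilon>) F H" .
qed

text \<open>
  \<open>L\<close> stands for $\ln\gamma$, with \<open>v = 0\<close> and \<open>L = 0\<close> in the degenerate case $\gamma = \infty$.
\<close>

lemma bias_variance_constants:
  assumes n: "n \<ge> 1"
    and T: "linear_functional_on D T" "F \<union> H \<subseteq> D"
    and F: "convex_fun_set F" and H: "convex_fun_set H" and h: "F \<inter> H \<noteq> {}"
    and w1: "omega1 T (noise n) F1 = ereal w1" "0 \<le> w1"
    and u: "omega T (noise n) F H \<noteq> \<infinity>"
    and w: "omega T (log_radius n (gam T n F1 F H)) F H = ereal w"
  obtains v L where "sigma_sq T n F1 F H = ereal v" "0 \<le> v" "v \<le> w\<^sup>2" "v * L \<le> w\<^sup>2" "0 \<le> L"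
    "v\<^sup>2 * exp (- 8 * L) \<le> w1 ^ 4" "bias_bound T n (ereal v) F H \<le> ereal (w / 2)" "0 \<le> w"
proof -
  have n0: "0 < real n" using n by simp
  have u0: "0 \<le> omega T (noise n) F H" by (rule omega_nonneg[OF h]) simp
  then obtain u' where u': "omega T (noise n) F H = ereal u'" "0 \<le> u'"
    using u by (cases "omega T (noise n) F H") auto
  \<comment> \<open>An affine majorant of the modulus with intercept \<open>w\<close> and slope
    sqrt(nv) bounds the supremum in \<open>bias_bound\<close> by \<open>w\<close>.\<close>
  have bias: "bias_bound T n (ereal v) F H \<le> ereal (w / 2)"
    if "0 \<le> v" and *: "\<And>\<epsilon>. 0 < \<epsilon> \<Longrightarrow> omega T (ereal \<epsilon>) F H \<le> ereal (w + sqrt (real n * v) * \<epsilon>)" for v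
  proof -
    have "(SUP \<epsilon>\<in>{0::real<..}. omega T (ereal \<epsilon>) F H - sqrt_ereal (ereal (real n) * ereal v) * ereal \<epsilon>)
        \<le> ereal w"
      using * by (intro SUP_least) (simp add: ereal_minus_le_iff add.commute)
    then have "bias_bound T n (ereal v) F H \<le> ereal (1 / 2) * ereal w"
      unfolding bias_bound_def by (rule ereal_mult_left_mono) simp
    then show ?thesis by simp
  qed
  \<comment> \<open>The ratio is infinite only for w1 = 0 < u'; the convention 0/0 = 0 puts w1 = u'
    = 0 into the finite case with \<gamma> = e. The inequality \<open>u' \<le> g * w1\<close>
    records that \<gamma> dominates the ratio without dividing by w1.\<close>
  consider (inf) "gam T n F1 F H = \<infinity>"
    | (fin) g where "gam T n F1 F H = ereal g" "exp 1 \<le> g" "u' \<le> g * w1"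
  proof (cases "w1 = 0")
    case True
    show ?thesis
    proof (cases "u' = 0")
      case u0: True
      show ?thesis
        by (rule fin[of "exp 1"]) (use True u0 u' w1 in \<open>auto simp: gam_def max_def zero_ereal_def[symmetric]\<close>)
    next
      case False
      then have "gam T n F1 F H = \<infinity>"
        using True u' w1 by (simp add: gam_def zero_ereal_def[symmetric] divide_ereal_def max_def)
      then show ?thesis by (rule inf)
    qed
  next
    case False
    then show ?thesis
      using u' w1 by (intro fin[of "max (exp 1) (u' / w1)"])
        (auto simp: gam_def max_def field_simps)
  qed
  then show thesis
  proof cases
    case inf
    have r: "log_radius n (gam T n F1 F H) = \<infinity>"
      using n0 by (simp add: log_radius_def inf ln_sqrt_ereal_infinity)
    have w0: "0 \<le> w"
      using omega_nonneg[OF h, of \<infinity> T] w r by simp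
    \<comment> \<open>Since ln \<gamma> is infinite and 1/\<infinity> = 0, the prescribed variance
      is 0. No multiple of \<epsilon> is then subtracted in the bias bound, and the modulus never
      exceeds \<open>w\<close>, its value at infinite radius.\<close>
    have s: "sigma_sq T n F1 F H = ereal 0"
      by (simp add: sigma_sq_def inf zero_ereal_def[symmetric] ln_sqrt_ereal_infinity)
    have le: "omega T (ereal \<epsilon>) F H \<le> ereal w" for \<epsilon>
      using omega_mono[of "ereal \<epsilon>" \<infinity> T F H] w r by simp
    show thesis
    proof (rule that[OF s, of 0])
      show "bias_bound T n (ereal 0) F H \<le> ereal (w / 2)"
        by (rule bias) (simp_all add: le)
    qed (use w0 w1 in simp_all)
  next
    case (fin g)
    define L where "L = ln g"
    have g: "g > 0" using fin(2) exp_gt_zero[of "1::real"] by linarith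
    have L: "1 \<le> L" using fin(2) g by (simp add: L_def ln_ge_iff)
    define \<rho> where "\<rho> = sqrt (L / real n)"
    have \<rho>0: "0 < \<rho>" using L n0 by (simp add: \<rho>_def)
    have \<rho>: "log_radius n (gam T n F1 F H) = ereal \<rho>"
      using g n0 by (simp add: log_radius_def fin L_def \<rho>_def)
    have w0: "0 \<le> w"
      using omega_nonneg[OF h, of "ereal \<rho>" T] w \<rho> \<rho>0 by simp
    define v where "v = w\<^sup>2 / L"
    have s: "sigma_sq T n F1 F H = ereal v"
      unfolding sigma_sq_def w using L g by (simp add: fin(1) L_def[symmetric] v_def one_ereal_def)
    note scale = omega_scale[OF T F H h]
    \<comment> \<open>The radius is sqrt(L) \<ge> 1 times the noise level, so scaling gives w \<le>
      sqrt(L) u'. Dividing w^2 by L thus brings the variance down to u'^2.\<close>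
    have "\<rho> = sqrt L * (1 / sqrt (real n))"
      by (simp add: \<rho>_def real_sqrt_divide)
    then have "ereal w \<le> ereal (sqrt L) * ereal u'"
      using scale[of "sqrt L" "1 / sqrt (real n)"] L u' w \<rho> by simp
    then have "w\<^sup>2 \<le> (sqrt L * u')\<^sup>2"
      using w0 by (intro power_mono) auto
    then have "w\<^sup>2 \<le> L * u'\<^sup>2" using L by (simp add: power_mult_distrib)
    then have vu: "v \<le> u'\<^sup>2" using L by (simp add: v_def field_simps)
    have v0: "0 \<le> v" using L by (simp add: v_def)
    \<comment> \<open>Replacing u' by w1 costs a factor g^4, which is more than repaid by exp(-8L) =
      g^(-8).\<close>
    have "v\<^sup>2 \<le> (u'\<^sup>2)\<^sup>2" using vu v0 by (intro power_mono)
    also have "\<dots> = u' ^ 4" by simp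
    also have "\<dots> \<le> (g * w1) ^ 4" using fin(3) u' by (intro power_mono)
    finally have v2: "v\<^sup>2 \<le> g ^ 4 * w1 ^ 4" by (simp add: power_mult_distrib)
    have g1: "1 \<le> g" using fin(2) one_le_exp_iff[of "1::real"] by linarith
    have "g ^ 4 * exp (- 8 * L) \<le> 1"
    proof -
      have "exp (8 * L) = g ^ 8"
        using exp_of_nat_mult[of 8 L] g by (simp add: L_def)
      moreover have "g ^ 4 \<le> g ^ 8" using g1 by (intro power_increasing) auto
      ultimately show ?thesis using g by (simp add: exp_minus field_simps)
    qed
    then have "(g ^ 4 * exp (- 8 * L)) * w1 ^ 4 \<le> 1 * w1 ^ 4"
      by (intro mult_right_mono) simp_all
    moreover have "v\<^sup>2 * exp (- 8 * L) \<le> (g ^ 4 * w1 ^ 4) * exp (- 8 * L)"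
      using v2 by (intro mult_right_mono) auto
    moreover have "(g ^ 4 * w1 ^ 4) * exp (- 8 * L) = (g ^ 4 * exp (- 8 * L)) * w1 ^ 4"
      by simp
    ultimately have c: "v\<^sup>2 * exp (- 8 * L) \<le> w1 ^ 4" by linarith
    have b: "bias_bound T n (ereal v) F H \<le> ereal (w / 2)"
    proof (rule bias[OF v0])
      fix \<epsilon> :: real assume \<epsilon>: "0 < \<epsilon>"
      \<comment> \<open>The slope is that of the line from the origin to (\<rho>, w). Up to \<rho>
        the modulus is at most \<open>w\<close> by monotonicity; beyond \<rho> it lies below this
        line by scaling.\<close>
      have sq: "sqrt (real n * v) = w / \<rho>"
        using w0 L n0 by (simp add: v_def \<rho>_def real_sqrt_divide real_sqrt_mult)
      show "omega T (ereal \<epsilon>) F H \<le> ereal (w + sqrt (real n * v) * \<epsilon>)"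
      proof (cases "\<epsilon> \<le> \<rho>")
        case True
        have "omega T (ereal \<epsilon>) F H \<le> ereal w"
          using omega_mono[of "ereal \<epsilon>" "ereal \<rho>" T F H] True w \<rho> by simp
        also have "\<dots> \<le> ereal (w + sqrt (real n * v) * \<epsilon>)"
          using \<epsilon> v0 by simp
        finally show ?thesis .
      next
        case False
        have "omega T (ereal \<epsilon>) F H \<le> ereal (\<epsilon> / \<rho>) * ereal w"
          using scale[of "\<epsilon> / \<rho>" \<rho>] False w \<rho> \<rho>0 by simp
        also have "\<dots> \<le> ereal (w + sqrt (real n * v) * \<epsilon>)"
          unfolding sq using w0 by (simp add: mult.commute)
        finally show ?thesis .
      qed
    qed
    have "v \<le> w\<^sup>2"
      using L by (simp add: v_def divide_le_eq mult_le_cancel_left1)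
    moreover have "v * L \<le> w\<^sup>2" using L by (simp add: v_def)
    ultimately show thesis
      using L by (intro that[OF s v0 _ _ _ c b w0]) simp_all
  qed
qed

section \<open>Risk of a selected estimator\<close>

context prob_space
begin

text \<open>One of the five w pays for the mean, leaving a deviation y = 4w + 2g with y^2 \<ge>
  16w^2 + 4g^2. In y^2/(2v) the first term gives at least 8L because vL \<le> w^2; the second gives
  2z with z = g^2/v, and exp(-2z) \<le> z^(-2) since z \<le> exp z.\<close>

lemma gaussian_deviation:
  assumes G: "gaussian_mgf X" and v: "variance X \<le> v" "v * L \<le> w\<^sup>2" and L: "0 \<le> L"
    and w: "0 \<le> w" "expectation X \<le> w" and g: "0 < g"
  shows "prob {x\<in>space M. 5 * w + 2 * g < X x} * g ^ 4 \<le> v\<^sup>2 * exp (- 8 * L)"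
proof -
  note [measurable] = gaussian_mgfD(1)[OF G]
  have v0: "0 \<le> v" using v(1) variance_positive[of X] by linarith
  show ?thesis
  proof (cases "v = 0")
    case True
    have "AE x in M. X x = expectation X"
      using True v by (intro variance_zero_AE gaussian_mgfD(4)[OF G]) auto
    then have "AE x in M. \<not> 5 * w + 2 * g < X x"
    proof eventually_elim
      case (elim x)
      then show ?case using w g by simp
    qed
    then have "prob {x\<in>space M. 5 * w + 2 * g < X x} = 0"
      by (subst prob_eq_0) auto
    then show ?thesis by simp
  next
    case False
    then have v1: "0 < v" using v0 by simp
    let ?y = "4 * w + 2 * g"
    have "prob {x\<in>space M. 5 * w + 2 * g < X x} \<le> prob {x\<in>space M. ?y \<le> X x - expectation X}"
      using w by (intro finite_measure_mono) auto
    also have "\<dots> \<le> exp (- ?y\<^sup>2 / (2 * v))"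
      using w g by (intro gaussian_tail[OF G v(1) v1]) auto
    also have "\<dots> \<le> exp (- 8 * L + (- 2 * (g\<^sup>2 / v)))"
    proof -
      have "16 * w\<^sup>2 + 4 * g\<^sup>2 \<le> ?y\<^sup>2" using w g by (simp add: power2_eq_square algebra_simps)
      then have "16 * (v * L) + 4 * g\<^sup>2 \<le> ?y\<^sup>2" using v(2) by linarith
      then show ?thesis using v1 by (simp add: field_simps)
    qed
    also have "\<dots> = exp (- 8 * L) * exp (- 2 * (g\<^sup>2 / v))" by (rule exp_add)
    also have "\<dots> \<le> exp (- 8 * L) * (v\<^sup>2 / g ^ 4)"
    proof (intro mult_left_mono)
      let ?z = "g\<^sup>2 / v"
      have z: "0 < ?z" using g v1 by simp
      have "?z \<le> exp ?z" using exp_ge_add_one_self[of ?z] by linarith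
      then have "?z\<^sup>2 \<le> (exp ?z)\<^sup>2" using z by (intro power_mono) auto
      also have "\<dots> = exp (2 * ?z)" by (rule exp_double[symmetric])
      finally have "inverse (exp (2 * ?z)) \<le> inverse (?z\<^sup>2)"
        using z by (intro le_imp_inverse_le) (use z in auto)
      then show "exp (- 2 * ?z) \<le> v\<^sup>2 / g ^ 4"
        by (simp add: exp_minus power_divide)
    qed simp
    finally have "prob {x\<in>space M. 5 * w + 2 * g < X x} * g ^ 4 \<le> exp (- 8 * L) * (v\<^sup>2 / g ^ 4) * g ^ 4"
      using g by (intro mult_right_mono) auto
    then show ?thesis using g by (simp add: mult.commute)
  qed
qed

text \<open>A pointwise arithmetic-geometric inequality weighted by q^2 plays the part of Jensen's
  inequality. For q = 0 the weight is undefined, but then the variable vanishes almost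
  surely.\<close>

lemma nn_integral_square_le_fourth:
  assumes [measurable]: "Z \<in> borel_measurable M"
    and Z: "(\<integral>\<^sup>+x. ennreal ((Z x) ^ 4) \<partial>M) \<le> ennreal (C * q ^ 4)" and q: "0 \<le> q" and C: "0 \<le> C"
  shows "(\<integral>\<^sup>+x. ennreal ((Z x)\<^sup>2) \<partial>M) \<le> ennreal ((1 + C) / 2 * q\<^sup>2)"
proof (cases "q = 0")
  case True
  then have "(\<integral>\<^sup>+x. ennreal ((Z x) ^ 4) \<partial>M) = 0" using Z by simp
  then have "AE x in M. ennreal ((Z x) ^ 4) = 0" by (subst (asm) nn_integral_0_iff_AE) auto
  then have "AE x in M. ennreal ((Z x)\<^sup>2) = 0"
    by eventually_elim (auto simp: ennreal_eq_0_iff power_le_zero_eq)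
  then have "(\<integral>\<^sup>+x. ennreal ((Z x)\<^sup>2) \<partial>M) = 0" by (subst nn_integral_0_iff_AE) auto
  then show ?thesis by simp
next
  case False
  then have q: "0 < q" using q by simp
  have "z\<^sup>2 \<le> q\<^sup>2 / 2 + 1 / (2 * q\<^sup>2) * z ^ 4" for z
  proof -
    have "0 \<le> (z\<^sup>2 - q\<^sup>2)\<^sup>2 / (2 * q\<^sup>2)" by simp
    also have "\<dots> = q\<^sup>2 / 2 + 1 / (2 * q\<^sup>2) * z ^ 4 - z\<^sup>2"
      using q by (simp add: field_simps power2_eq_square power4_eq_xxxx)
    finally show ?thesis by simp
  qed
  then have "(\<integral>\<^sup>+x. ennreal ((Z x)\<^sup>2) \<partial>M) \<le> (\<integral>\<^sup>+x. ennreal (q\<^sup>2 / 2) + ennreal (1 / (2 * q\<^sup>2)) * ennreal ((Z x) ^ 4) \<partial>M)"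
    by (intro nn_integral_mono) (simp add: ennreal_mult[symmetric] ennreal_plus[symmetric] del: ennreal_plus)
  also have "\<dots> = ennreal (q\<^sup>2 / 2) + ennreal (1 / (2 * q\<^sup>2)) * (\<integral>\<^sup>+x. ennreal ((Z x) ^ 4) \<partial>M)"
    by (subst nn_integral_add) (auto simp: nn_integral_cmult emeasure_space_1)
  also have "\<dots> \<le> ennreal (q\<^sup>2 / 2) + ennreal (1 / (2 * q\<^sup>2)) * ennreal (C * q ^ 4)"
    by (intro add_left_mono mult_left_mono Z) simp
  also have "\<dots> = ennreal ((1 + C) / 2 * q\<^sup>2)"
    using q C by (simp add: ennreal_mult[symmetric] ennreal_plus[symmetric] field_simps power2_eq_square
      power4_eq_xxxx del: ennreal_plus)
  finally show ?thesis .
qed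

text \<open>
  On the complement of \<open>A\<close> the square is bounded by $\frac a2 + \frac 1{2a} z^4$ with
  $a = g^4/w^2$, which replaces the Cauchy-Schwarz inequality and avoids square roots.
\<close>

lemma selection_risk_rare_switch:
  assumes [measurable]: "X \<in> borel_measurable M" "Y \<in> borel_measurable M" "Measurable.pred M A"
    and X: "(\<integral>\<^sup>+x. ennreal ((X x - \<theta>)\<^sup>2) \<partial>M) \<le> ennreal (w\<^sup>2)"
    and Y: "(\<integral>\<^sup>+x. ennreal ((Y x - \<theta>) ^ 4) \<partial>M) \<le> ennreal (C * g ^ 4)"
    and A: "prob {x\<in>space M. \<not> A x} * g ^ 4 \<le> 4 * w ^ 4"
    and g: "0 \<le> g" and w: "0 \<le> w" and C: "0 \<le> C"
  shows "(\<integral>\<^sup>+x. ennreal (((if A x then X x else Y x) - \<theta>)\<^sup>2) \<partial>M) \<le> ennreal ((3 + C / 2) * w\<^sup>2)"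
proof -
  \<comment> \<open>The weight g^4/w^2 needs both numbers positive. If g = 0, the hypothesis on
    \<open>A\<close> is void but \<open>Y\<close> equals \<theta> almost surely; if w = 0 < g, the
    switch to \<open>Y\<close> has probability 0.\<close>
  consider (g0) "g = 0" | (w0) "0 < g" "w = 0" | (pos) "0 < g" "0 < w"
    using g w by fastforce
  then show ?thesis
  proof cases
    case g0
    have "(\<integral>\<^sup>+x. ennreal (((if A x then X x else Y x) - \<theta>)\<^sup>2) \<partial>M)
        \<le> (\<integral>\<^sup>+x. ennreal ((X x - \<theta>)\<^sup>2) + ennreal ((Y x - \<theta>)\<^sup>2) \<partial>M)"
      by (intro nn_integral_mono) (simp add: add_increasing add_increasing2)
    also have "\<dots> = (\<integral>\<^sup>+x. ennreal ((X x - \<theta>)\<^sup>2) \<partial>M) + (\<integral>\<^sup>+x. ennreal ((Y x - \<theta>)\<^sup>2) \<partial>M)"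
      by (simp add: nn_integral_add)
    also have "\<dots> \<le> ennreal (w\<^sup>2) + ennreal ((1 + C) / 2 * g\<^sup>2)"
      by (intro add_mono X nn_integral_square_le_fourth Y g C) simp
    also have "\<dots> \<le> ennreal ((3 + C / 2) * w\<^sup>2)"
    proof -
      have "1 * w\<^sup>2 \<le> (3 + C / 2) * w\<^sup>2" using C by (intro mult_right_mono) auto
      then show ?thesis using g0 by (simp add: ennreal_leI)
    qed
    finally show ?thesis .
  next
    case w0
    note g = w0(1) and True = w0(2)
    have "prob {x\<in>space M. \<not> A x} = 0"
      using A g True by (simp add: mult_le_0_iff measure_le_0_iff)
    then have "AE x in M. A x" by (subst (asm) prob_eq_0) auto
    then have "(\<integral>\<^sup>+x. ennreal (((if A x then X x else Y x) - \<theta>)\<^sup>2) \<partial>M) = (\<integral>\<^sup>+x. ennreal ((X x - \<theta>)\<^sup>2) \<partial>M)"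
      by (intro nn_integral_cong_AE) auto
    then show ?thesis using X True by simp
  next
    case pos
    note g = pos(1) and w = pos(2)
    \<comment> \<open>With this weight the switching term is at most 2w^2 and the fourth-moment term
      is exactly Cw^2/2; together with the risk w^2 of \<open>X\<close> they give the constant 3 +
      C/2.\<close>
    define a where "a = g ^ 4 / w\<^sup>2"
    have a: "0 < a" using g w by (simp add: a_def)
    have amgm: "z\<^sup>2 \<le> a / 2 + 1 / (2 * a) * z ^ 4" for z :: real
    proof -
      have "0 \<le> (z\<^sup>2 - a)\<^sup>2 / (2 * a)" using a by simp
      also have "\<dots> = a / 2 + 1 / (2 * a) * z ^ 4 - z\<^sup>2"
        using a by (simp add: field_simps power2_eq_square power4_eq_xxxx)
      finally show ?thesis by simp
    qed
    have "(\<integral>\<^sup>+x. ennreal (((if A x then X x else Y x) - \<theta>)\<^sup>2) \<partial>M)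
        \<le> (\<integral>\<^sup>+x. ennreal ((X x - \<theta>)\<^sup>2) + (ennreal (a / 2) * indicator {x\<in>space M. \<not> A x} x
              + ennreal (1 / (2 * a)) * ennreal ((Y x - \<theta>) ^ 4)) \<partial>M)"
    proof (intro nn_integral_mono)
      fix x assume x: "x \<in> space M"
      show "ennreal (((if A x then X x else Y x) - \<theta>)\<^sup>2) \<le> ennreal ((X x - \<theta>)\<^sup>2)
          + (ennreal (a / 2) * indicator {x\<in>space M. \<not> A x} x + ennreal (1 / (2 * a)) * ennreal ((Y x - \<theta>) ^ 4))"
      proof (cases "A x")
        case True
        then show ?thesis by simp
      next
        case False
        have "ennreal ((Y x - \<theta>)\<^sup>2) \<le> ennreal (a / 2) + ennreal (1 / (2 * a)) * ennreal ((Y x - \<theta>) ^ 4)"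
          using amgm[of "Y x - \<theta>"] a
          by (simp add: ennreal_mult[symmetric] ennreal_plus[symmetric] del: ennreal_plus)
        then show ?thesis using False x by (simp add: add_increasing)
      qed
    qed
    also have "\<dots> = (\<integral>\<^sup>+x. ennreal ((X x - \<theta>)\<^sup>2) \<partial>M) + (ennreal (a / 2) * emeasure M {x\<in>space M. \<not> A x}
        + ennreal (1 / (2 * a)) * (\<integral>\<^sup>+x. ennreal ((Y x - \<theta>) ^ 4) \<partial>M))"
      by (simp add: nn_integral_add nn_integral_cmult nn_integral_cmult_indicator)
    also have "\<dots> \<le> ennreal (w\<^sup>2) + (ennreal (a / 2) * ennreal (prob {x\<in>space M. \<not> A x})
        + ennreal (1 / (2 * a)) * ennreal (C * g ^ 4))"
      by (intro add_mono mult_left_mono X Y) (simp_all add: emeasure_eq_measure)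
    also have "\<dots> = ennreal (w\<^sup>2 + a / 2 * prob {x\<in>space M. \<not> A x} + 1 / (2 * a) * (C * g ^ 4))"
      using a C g by (simp add: ennreal_mult[symmetric] ennreal_plus[symmetric] del: ennreal_plus)
    also have "\<dots> \<le> ennreal ((3 + C / 2) * w\<^sup>2)"
    proof (rule ennreal_leI)
      have "a / 2 * prob {x\<in>space M. \<not> A x} = (prob {x\<in>space M. \<not> A x} * g ^ 4) / (2 * w\<^sup>2)"
        by (simp add: a_def mult.commute)
      also have "\<dots> \<le> (4 * w ^ 4) / (2 * w\<^sup>2)" by (intro divide_right_mono A) simp
      also have "\<dots> = 2 * w\<^sup>2" using w by (simp add: field_simps power2_eq_square power4_eq_xxxx)
      finally have "a / 2 * prob {x\<in>space M. \<not> A x} \<le> 2 * w\<^sup>2" .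
      moreover have "1 / (2 * a) * (C * g ^ 4) = C / 2 * w\<^sup>2"
        using g w by (simp add: a_def)
      ultimately show "w\<^sup>2 + a / 2 * prob {x\<in>space M. \<not> A x} + 1 / (2 * a) * (C * g ^ 4) \<le> (3 + C / 2) * w\<^sup>2"
        by (simp add: algebra_simps)
    qed
    finally show ?thesis .
  qed
qed

text \<open>The slack is $14 q$ because $5 (w_1 + w) + 4 g \<le> 14 q$ when each of $w_1, w, g$ is at most $q$.\<close>

lemma selection_risk_sandwich:
  assumes G: "gaussian_mgf Xl" "gaussian_mgf Xu" and [measurable]: "Y \<in> borel_measurable M"
    and var: "variance Xl \<le> q\<^sup>2" "variance Xu \<le> q\<^sup>2"
    and bias: "\<theta> - q \<le> expectation Xl" "expectation Xu \<le> \<theta> + q"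
    and A: "\<And>x. A x \<Longrightarrow> Xl x - 14 * q \<le> X x" "\<And>x. A x \<Longrightarrow> X x \<le> Xu x + 14 * q"
    and Y: "(\<integral>\<^sup>+x. ennreal ((Y x - \<theta>) ^ 4) \<partial>M) \<le> ennreal (C * q ^ 4)"
    and q: "0 \<le> q" and C: "0 \<le> C"
  shows "(\<integral>\<^sup>+x. ennreal (((if A x then X x else Y x) - \<theta>)\<^sup>2) \<partial>M) \<le> ennreal ((905 + C) * q\<^sup>2)"
proof -
  note [measurable] = gaussian_mgfD(1)[OF G(1)] gaussian_mgfD(1)[OF G(2)]
  let ?l = "\<lambda>x. (Xl x - expectation Xl)\<^sup>2" and ?u = "\<lambda>x. (Xu x - expectation Xu)\<^sup>2"
  \<comment> \<open>The 15q combines the slack 14q with a bias of at most q. The sign of z decides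
    which endpoint bounds its modulus, and the sum of both alternatives is a bound valid in either
    case.\<close>
  have square: "z\<^sup>2 \<le> 2 * a\<^sup>2 + 2 * b\<^sup>2 + 900 * q\<^sup>2"
    if "a - 15 * q \<le> z" "z \<le> b + 15 * q" for z a b
  proof -
    have sq2: "(s + t)\<^sup>2 \<le> 2 * s\<^sup>2 + 2 * t\<^sup>2" for s t :: real
      using zero_le_power2[of "s - t"] by (simp add: power2_eq_square algebra_simps)
    have "z\<^sup>2 \<le> (\<bar>a\<bar> + 15 * q)\<^sup>2 \<or> z\<^sup>2 \<le> (\<bar>b\<bar> + 15 * q)\<^sup>2"
      using that q by (cases "0 \<le> z") (auto simp: abs_le_square_iff[symmetric])
    moreover have "(\<bar>c\<bar> + 15 * q)\<^sup>2 \<le> 2 * c\<^sup>2 + 450 * q\<^sup>2" for c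
      using sq2[of "\<bar>c\<bar>" "15 * q"] by (simp add: power_mult_distrib)
    ultimately show ?thesis
      using zero_le_power2[of a] zero_le_power2[of b] zero_le_power2[of q] by (smt (verit))
  qed
  have "(\<integral>\<^sup>+x. ennreal (((if A x then X x else Y x) - \<theta>)\<^sup>2) \<partial>M)
      \<le> (\<integral>\<^sup>+x. (ennreal (2 * ?l x + 2 * ?u x) + ennreal (900 * q\<^sup>2)) + ennreal ((Y x - \<theta>)\<^sup>2) \<partial>M)"
  proof (intro nn_integral_mono)
    fix x
    show "ennreal (((if A x then X x else Y x) - \<theta>)\<^sup>2)
      \<le> (ennreal (2 * ?l x + 2 * ?u x) + ennreal (900 * q\<^sup>2)) + ennreal ((Y x - \<theta>)\<^sup>2)"
    proof (cases "A x")
      case True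
      have "(X x - \<theta>)\<^sup>2 \<le> 2 * ?l x + 2 * ?u x + 900 * q\<^sup>2"
        using A[OF True] bias by (intro square) auto
      then show ?thesis using True
        by (simp add: ennreal_plus[symmetric] add_increasing2 del: ennreal_plus)
    next
      case False
      then show ?thesis by (simp add: add_increasing)
    qed
  qed
  also have "\<dots> = ((\<integral>\<^sup>+x. ennreal (2 * ?l x + 2 * ?u x) \<partial>M) + ennreal (900 * q\<^sup>2))
      + (\<integral>\<^sup>+x. ennreal ((Y x - \<theta>)\<^sup>2) \<partial>M)"
    by (simp add: nn_integral_add emeasure_space_1 del: ennreal_plus)
  also have "(\<integral>\<^sup>+x. ennreal (2 * ?l x + 2 * ?u x) \<partial>M) = ennreal (2 * variance Xl + 2 * variance Xu)"
    using gaussian_mgfD(4)[OF G(1)] gaussian_mgfD(4)[OF G(2)]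
    by (subst nn_integral_eq_integral) auto
  also have "(ennreal (2 * variance Xl + 2 * variance Xu) + ennreal (900 * q\<^sup>2))
      + (\<integral>\<^sup>+x. ennreal ((Y x - \<theta>)\<^sup>2) \<partial>M)
      \<le> (ennreal (4 * q\<^sup>2) + ennreal (900 * q\<^sup>2)) + ennreal ((1 + C) / 2 * q\<^sup>2)"
    using var by (intro add_mono ennreal_leI nn_integral_square_le_fourth Y q C order_refl) auto
  also have "\<dots> = ennreal (4 * q\<^sup>2 + 900 * q\<^sup>2 + (1 + C) / 2 * q\<^sup>2)"
    using C by (simp add: ennreal_plus[symmetric] del: ennreal_plus)
  \<comment> \<open>Rounding: 4 + 900 + (1 + C)/2 \<le> 905 + C.\<close>
  also have "\<dots> \<le> ennreal ((905 + C) * q\<^sup>2)"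
  proof (rule ennreal_leI)
    have "0 \<le> (1 / 2 + C / 2) * q\<^sup>2" using C by simp
    then show "4 * q\<^sup>2 + 900 * q\<^sup>2 + (1 + C) / 2 * q\<^sup>2 \<le> (905 + C) * q\<^sup>2"
      by (simp add: algebra_simps)
  qed
  finally show ?thesis .
qed

end

section \<open>Probability of violating one acceptance constraint\<close>

context prob_space
begin

lemma mean_square_error_bounds:
  assumes G: "gaussian_mgf Y" and Y: "(\<integral>\<^sup>+x. ennreal ((Y x - \<theta>)\<^sup>2) \<partial>M) \<le> ennreal (w\<^sup>2)"
    and w: "0 \<le> w"
  shows "variance Y \<le> w\<^sup>2" "\<bar>expectation Y - \<theta>\<bar> \<le> w"
proof -
  note i = gaussian_mgfD(2,3)[OF G]
  have "expectation (\<lambda>x. (Y x - \<theta>)\<^sup>2) \<le> w\<^sup>2"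
    using Y by (subst (asm) nn_integral_eq_integral) (auto simp: gaussian_mgfD(4)[OF G])
  moreover have "expectation (\<lambda>x. (Y x - \<theta>)\<^sup>2) = variance Y + (expectation Y - \<theta>)\<^sup>2"
    using i by (simp add: power2_diff prob_space algebra_simps power2_eq_square[of "expectation Y"])
  ultimately have *: "variance Y + (expectation Y - \<theta>)\<^sup>2 \<le> w\<^sup>2" by simp
  then show "variance Y \<le> w\<^sup>2" using zero_le_power2[of "expectation Y - \<theta>"] by linarith
  have "(expectation Y - \<theta>)\<^sup>2 \<le> w\<^sup>2" using * variance_positive[of Y] by linarith
  then show "\<bar>expectation Y - \<theta>\<bar> \<le> w" using w by (simp add: abs_le_square_iff[symmetric])
qed

text \<open>If the constraint fails, either X - \<theta> exceeds 5w + 2g or \<theta> - Y exceeds 5w1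
  + 2g, so \<open>gaussian_deviation\<close> applies to each. Keeping g^4 as a factor on the left
  makes the case g = 0 harmless.\<close>

lemma gap_probability:
  assumes G: "gaussian_mgf X" "gaussian_mgf Y"
    and Y: "(\<integral>\<^sup>+x. ennreal ((Y x - \<theta>)\<^sup>2) \<partial>M) \<le> ennreal (w1\<^sup>2)"
    and X: "variance X \<le> v" "expectation X \<le> \<theta> + w"
    and v: "v * L \<le> w\<^sup>2" "v\<^sup>2 * exp (- 8 * L) \<le> w1 ^ 4"
    and nonneg: "0 \<le> L" "0 \<le> w" "0 \<le> w1" "0 \<le> g"
  shows "prob {x\<in>space M. \<not> (X x - 5 * (w1 + w) - 4 * g \<le> Y x)} * g ^ 4 \<le> 2 * w1 ^ 4"
proof (cases "g = 0")
  case True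
  then show ?thesis using nonneg by simp
next
  case False
  then have g: "0 < g" using nonneg by simp
  note [measurable] = gaussian_mgfD(1)[OF G(1)] gaussian_mgfD(1)[OF G(2)]
  note mY = mean_square_error_bounds[OF G(2) Y nonneg(3)]
  let ?X = "\<lambda>x. - \<theta> + 1 * X x" and ?Y = "\<lambda>x. \<theta> + (-1) * Y x"
  have "prob {x\<in>space M. 5 * w + 2 * g < ?X x} * g ^ 4 \<le> v\<^sup>2 * exp (- 8 * L)"
  proof (rule gaussian_deviation[OF gaussian_mgf_affine(1)[OF G(1)] _ v(1) nonneg(1,2) _ g])
    show "variance ?X \<le> v" using gaussian_mgf_affine(3)[OF G(1), of "- \<theta>" 1] X by simp
    show "expectation ?X \<le> w" using gaussian_mgf_affine(2)[OF G(1), of "- \<theta>" 1] X by simp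
  qed
  \<comment> \<open>Here L = 0 suffices: the variance bound w1^2 squares to w1^4, so no exponential
    gain is required.\<close>
  moreover have "prob {x\<in>space M. 5 * w1 + 2 * g < ?Y x} * g ^ 4 \<le> (w1\<^sup>2)\<^sup>2 * exp (- 8 * 0)"
  proof (rule gaussian_deviation[OF gaussian_mgf_affine(1)[OF G(2)] _ _ order_refl nonneg(3) _ g])
    show "variance ?Y \<le> w1\<^sup>2" using gaussian_mgf_affine(3)[OF G(2), of \<theta> "-1"] mY by simp
    show "expectation ?Y \<le> w1" using gaussian_mgf_affine(2)[OF G(2), of \<theta> "-1"] mY by simp
  qed simp
  moreover have "prob {x\<in>space M. \<not> (X x - 5 * (w1 + w) - 4 * g \<le> Y x)}
      \<le> prob {x\<in>space M. 5 * w + 2 * g < ?X x} + prob {x\<in>space M. 5 * w1 + 2 * g < ?Y x}"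
    by (rule order_trans[OF finite_measure_mono measure_Un_le]) auto
  then have "prob {x\<in>space M. \<not> (X x - 5 * (w1 + w) - 4 * g \<le> Y x)} * g ^ 4
      \<le> (prob {x\<in>space M. 5 * w + 2 * g < ?X x} + prob {x\<in>space M. 5 * w1 + 2 * g < ?Y x}) * g ^ 4"
    using g by (intro mult_right_mono) auto
  ultimately show ?thesis
    using v(2) by (simp add: distrib_right)
qed

end

section \<open>Comparison of radii and bias of the auxiliary estimators\<close>

lemma log_radius_mono:
  assumes "n \<ge> 1" "ereal (exp 1) \<le> a" "a \<le> b"
  shows "noise n \<le> log_radius n a" "log_radius n a \<le> log_radius n b"
proof -
  have n: "0 < real n" using assms(1) by simp
  have real: "noise n \<le> log_radius n (ereal r)" "log_radius n (ereal r) \<le> log_radius n (ereal s)"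
    if "exp 1 \<le> r" "r \<le> s" for r s
  proof -
    have r: "0 < r" using that(1) exp_gt_zero[of "1::real"] by linarith
    \<comment> \<open>The floor e in the definition of \<gamma> makes the logarithm at least 1, so
      the radius never falls below the noise level.\<close>
    then have "1 \<le> ln r" "ln r \<le> ln s" using that by (simp_all add: ln_ge_iff)
    then show "noise n \<le> log_radius n (ereal r)" "log_radius n (ereal r) \<le> log_radius n (ereal s)"
      using r that n by (simp_all add: log_radius_def real_sqrt_divide divide_right_mono)
  qed
  have inf: "log_radius n \<infinity> = \<infinity>"
    using n by (simp add: log_radius_def ln_sqrt_ereal_infinity)
  show "noise n \<le> log_radius n a" using assms real(1) inf by (cases a) auto
  show "log_radius n a \<le> log_radius n b" using assms real(2) inf by (cases a; cases b) auto
qed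

lemma gam_le_gam_plus:
  assumes "0 \<le> omega1 T (noise n) F1"
  shows "gam T n F1 F1 F2 \<le> gam_plus T n F1 F2" "gam T n F1 F2 F1 \<le> gam_plus T n F1 F2"
  unfolding gam_def gam_plus_def divide_ereal_def
  using assms by (intro max.mono order_refl ereal_mult_right_mono omega_le_omega_plus
    ereal_inverse_nonneg_iff[THEN iffD2] disjI1; simp)+

lemma enn2ereal_le_ereal_iff: "0 \<le> c \<Longrightarrow> enn2ereal x \<le> ereal c \<longleftrightarrow> x \<le> ennreal c"
  by (simp add: less_eq_ennreal.rep_eq)

lemma (in brownian_motion) bias_variance_estimator_bounds:
  assumes \<delta>: "bias_variance_estimator M W n T (ereal v) Fi Fj \<delta>"
    and bias: "bias_bound T n (ereal v) Fi Fj \<le> ereal (w / 2)" and w: "0 \<le> w" and f: "f \<in> L2"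
  shows "gaussian_mgf (\<lambda>x. \<delta> (obs W n f x))" "variance (\<lambda>x. \<delta> (obs W n f x)) \<le> v"
    "f \<in> Fi \<Longrightarrow> expectation (\<lambda>x. \<delta> (obs W n f x)) \<le> T f + w"
    "f \<in> Fj \<Longrightarrow> T f - w \<le> expectation (\<lambda>x. \<delta> (obs W n f x))"
proof -
  show "gaussian_mgf (\<lambda>x. \<delta> (obs W n f x))"
    using \<delta> f gaussian_mgf_linear_estimator unfolding bias_variance_estimator_def by blast
  show "variance (\<lambda>x. \<delta> (obs W n f x)) \<le> v"
    using \<delta> f unfolding bias_variance_estimator_def var_est_def by simp
  {
    assume "f \<in> Fi"
    then have "ereal (mean_est M W n \<delta> f - T f) \<le> (SUP f\<in>Fi. ereal (mean_est M W n \<delta> f - T f))"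
      by (rule SUP_upper)
    also have "\<dots> \<le> ereal (w / 2)"
      using \<delta> bias unfolding bias_variance_estimator_def by (meson order_trans)
    finally show "expectation (\<lambda>x. \<delta> (obs W n f x)) \<le> T f + w"
      using w by (simp add: mean_est_def)
  next
    assume "f \<in> Fj"
    have "- ereal (w / 2) \<le> - bias_bound T n (ereal v) Fi Fj"
      using bias by (simp only: ereal_minus_le_minus)
    also have "\<dots> \<le> (INF f\<in>Fj. ereal (mean_est M W n \<delta> f - T f))"
      using \<delta> unfolding bias_variance_estimator_def by blast
    also have "\<dots> \<le> ereal (mean_est M W n \<delta> f - T f)"
      using \<open>f \<in> Fj\<close> by (rule INF_lower)
    finally show "T f - w \<le> expectation (\<lambda>x. \<delta> (obs W n f x))"
      using w by (simp add: mean_est_def)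
  }
qed

section \<open>Risk of the adaptive estimator over each parameter space\<close>

context brownian_motion
begin

lemma adaptive_est_eq:
  "adaptive_est T n F1 F2 \<delta>1 \<delta>2 \<delta>12 \<delta>21 y = (if accept T n F1 F2 \<delta>1 \<delta>12 \<delta>21 y then \<delta>1 y else \<delta>2 y)"
  by (simp add: adaptive_est_def)

lemma measurable_accept:
  assumes "estimator \<delta>1" "estimator \<delta>12" "estimator \<delta>21"
  shows "Measurable.pred M (\<lambda>x. accept T n F1 F2 \<delta>1 \<delta>12 \<delta>21 (obs W n f x))"
proof -
  note [measurable] = assms[THEN measurable_estimator, of n f]
  show ?thesis unfolding accept_def by measurable
qed

text \<open>On \<open>F1\<close> the bias of \<open>\<delta>12\<close> is bounded above and that of
  \<open>\<delta>21\<close> below, so each constraint fails only through a large deviation. Each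
  failure contributes 2 w1^4 to the hypothesis of \<open>selection_risk_rare_switch\<close>.\<close>

lemma adaptive_risk_F1:
  assumes n: "n \<ge> 1"
    and T: "linear_functional_on D T" "F1 \<union> F2 \<subseteq> D"
    and F: "convex_fun_set F1" "convex_fun_set F2" "F1 \<inter> F2 \<noteq> {}"
    and \<delta>1: "linear_estimator M W n \<delta>1" and \<delta>2: "estimator \<delta>2"
    and w1: "omega1 T (noise n) F1 = ereal w1" "0 \<le> w1"
    and g: "omega1 T (noise n) (F1 \<union> F2) = ereal g" "0 \<le> g"
    and \<delta>12: "bias_variance_estimator M W n T (sigma_sq T n F1 F1 F2) F1 F2 \<delta>12"
    and \<delta>21: "bias_variance_estimator M W n T (sigma_sq T n F1 F2 F1) F2 F1 \<delta>21"
    and f: "f \<in> F1" "f \<in> L2" and C: "0 \<le> C"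
    and r1: "risk M W n 2 \<delta>1 f (T f) \<le> ereal (w1\<^sup>2)"
    and r2: "risk M W n 4 \<delta>2 f (T f) \<le> ereal (C * g ^ 4)"
  shows "risk M W n 2 (adaptive_est T n F1 F2 \<delta>1 \<delta>2 \<delta>12 \<delta>21) f (T f) \<le> ereal ((3 + C / 2) * w1\<^sup>2)"
proof -
  let ?o = "obs W n f"
  let ?A = "\<lambda>x. accept T n F1 F2 \<delta>1 \<delta>12 \<delta>21 (?o x)"
  have e: "estimator \<delta>1" "estimator \<delta>12" "estimator \<delta>21"
    using \<delta>1 \<delta>12 \<delta>21 by (auto simp: linear_estimator_def bias_variance_estimator_def)
  note [measurable] = measurable_accept[OF e, of T n F1 F2 f] measurable_estimator[OF \<delta>2, of n f]
    e[THEN measurable_estimator, of n f]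
  have r1': "(\<integral>\<^sup>+x. ennreal ((\<delta>1 (?o x) - T f)\<^sup>2) \<partial>M) \<le> ennreal (w1\<^sup>2)"
    using r1 by (simp add: risk_def enn2ereal_le_ereal_iff)
  have r2': "(\<integral>\<^sup>+x. ennreal ((\<delta>2 (?o x) - T f) ^ 4) \<partial>M) \<le> ennreal (C * g ^ 4)"
    using r2 C g by (simp add: risk_def enn2ereal_le_ereal_iff)
  have G1: "gaussian_mgf (\<lambda>x. \<delta>1 (?o x))"
    by (rule gaussian_mgf_linear_estimator[OF \<delta>1 f(2)])
  have le: "omega T (noise n) F1 F2 \<le> ereal g" "omega T (noise n) F2 F1 \<le> ereal g"
    unfolding g(1)[symmetric] by (auto intro!: omega_mono_sets)
  define w12 where "w12 = omega T (log_radius n (gam T n F1 F1 F2)) F1 F2"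
  define w21 where "w21 = omega T (log_radius n (gam T n F1 F2 F1)) F2 F1"
  have lr: "0 \<le> log_radius n (gam T n F1 Fi Fj)" for Fi Fj
    by (rule order_trans[OF _ log_radius_mono(1)[OF n _ order_refl]]) (simp_all add: gam_def)
  have w12: "0 \<le> w12" "0 \<le> w21"
    unfolding w12_def w21_def using F(3) lr by (auto intro!: omega_nonneg)
  have A: "?A x \<longleftrightarrow> ereal (\<delta>12 (?o x)) - 5 * (ereal w1 + w12) - 4 * ereal g \<le> ereal (\<delta>1 (?o x)) \<and>
      ereal (\<delta>1 (?o x)) \<le> ereal (\<delta>21 (?o x)) + 5 * (ereal w1 + w21) + 4 * ereal g" for x
    by (simp add: accept_def bdev_def w1 g w12_def w21_def)
  \<comment> \<open>An infinite \<open>w12\<close> makes the constraint void, so the event is empty;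
    only the finite case needs \<open>gap_probability\<close>.\<close>
  have low: "prob {x\<in>space M. \<not> (ereal (\<delta>12 (?o x)) - 5 * (ereal w1 + w12) - 4 * ereal g \<le> ereal (\<delta>1 (?o x)))} * g ^ 4
      \<le> 2 * w1 ^ 4"
  proof (cases w12)
    case (real w)
    obtain v L where vL: "sigma_sq T n F1 F1 F2 = ereal v" "v * L \<le> w\<^sup>2" "0 \<le> L"
        "v\<^sup>2 * exp (- 8 * L) \<le> w1 ^ 4" "bias_bound T n (ereal v) F1 F2 \<le> ereal (w / 2)" "0 \<le> w"
      by (rule bias_variance_constants[OF n T F w1 _ real[unfolded w12_def]]) (use le in auto)
    note b = bias_variance_estimator_bounds[OF \<delta>12[unfolded vL(1)] vL(5,6) f(2)]
    show ?thesis
      using gap_probability[OF b(1) G1 r1' b(2) b(3)[OF f(1)] vL(2,4,3,6) w1(2) g(2)]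
      by (simp add: real)
  qed (use w12 w1 in auto)
  have up: "prob {x\<in>space M. \<not> (ereal (\<delta>1 (?o x)) \<le> ereal (\<delta>21 (?o x)) + 5 * (ereal w1 + w21) + 4 * ereal g)} * g ^ 4
      \<le> 2 * w1 ^ 4"
  proof (cases w21)
    case (real w)
    have T': "F2 \<union> F1 \<subseteq> D" "F2 \<inter> F1 \<noteq> {}" using T F by auto
    obtain v L where vL: "sigma_sq T n F1 F2 F1 = ereal v" "v * L \<le> w\<^sup>2" "0 \<le> L"
        "v\<^sup>2 * exp (- 8 * L) \<le> w1 ^ 4" "bias_bound T n (ereal v) F2 F1 \<le> ereal (w / 2)" "0 \<le> w"
      by (rule bias_variance_constants[OF n T(1) T'(1) F(2,1) T'(2) w1 _ real[unfolded w21_def]]) (use le in auto)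
    note b = bias_variance_estimator_bounds[OF \<delta>21[unfolded vL(1)] vL(5,6) f(2)]
    \<comment> \<open>Changing the signs of both estimators and of the target turns the upper
      constraint into the lower one.\<close>
    let ?X = "\<lambda>x. 0 + (-1) * \<delta>21 (?o x)" and ?Y = "\<lambda>x. 0 + (-1) * \<delta>1 (?o x)"
    have "prob {x\<in>space M. \<not> (?X x - 5 * (w1 + w) - 4 * g \<le> ?Y x)} * g ^ 4 \<le> 2 * w1 ^ 4"
    proof (rule gap_probability[OF gaussian_mgf_affine(1)[OF b(1)] gaussian_mgf_affine(1)[OF G1]
          _ _ _ vL(2,4,3,6) w1(2) g(2)])
      show "variance ?X \<le> v" using gaussian_mgf_affine(3)[OF b(1), of 0 "-1"] b(2) by simp
      show "expectation ?X \<le> - T f + w"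
        using gaussian_mgf_affine(2)[OF b(1), of 0 "-1"] b(4)[OF f(1)] by simp
      have "(?Y x - - T f)\<^sup>2 = (\<delta>1 (?o x) - T f)\<^sup>2" for x
        by (simp add: power2_eq_square algebra_simps)
      then show "(\<integral>\<^sup>+x. ennreal ((?Y x - - T f)\<^sup>2) \<partial>M) \<le> ennreal (w1\<^sup>2)"
        using r1' by simp
    qed
    moreover have "(ereal (\<delta>1 (?o x)) \<le> ereal (\<delta>21 (?o x)) + 5 * (ereal w1 + w21) + 4 * ereal g)
        \<longleftrightarrow> (?X x - 5 * (w1 + w) - 4 * g \<le> ?Y x)" for x
      by (auto simp: real)
    ultimately show ?thesis by simp
  qed (use w12 w1 in auto)
  have "prob {x\<in>space M. \<not> ?A x}
      \<le> prob {x\<in>space M. \<not> (ereal (\<delta>12 (?o x)) - 5 * (ereal w1 + w12) - 4 * ereal g \<le> ereal (\<delta>1 (?o x)))}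
       + prob {x\<in>space M. \<not> (ereal (\<delta>1 (?o x)) \<le> ereal (\<delta>21 (?o x)) + 5 * (ereal w1 + w21) + 4 * ereal g)}"
    unfolding A by (rule order_trans[OF finite_measure_mono measure_Un_le]) auto
  then have "prob {x\<in>space M. \<not> ?A x} * g ^ 4
      \<le> (prob {x\<in>space M. \<not> (ereal (\<delta>12 (?o x)) - 5 * (ereal w1 + w12) - 4 * ereal g \<le> ereal (\<delta>1 (?o x)))}
       + prob {x\<in>space M. \<not> (ereal (\<delta>1 (?o x)) \<le> ereal (\<delta>21 (?o x)) + 5 * (ereal w1 + w21) + 4 * ereal g)}) * g ^ 4"
    using g by (intro mult_right_mono) auto
  then have "prob {x\<in>space M. \<not> ?A x} * g ^ 4 \<le> 4 * w1 ^ 4"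
    using low up unfolding distrib_right by linarith
  from selection_risk_rare_switch[OF _ _ _ r1' r2' this g(2) w1(2) C] show ?thesis
    using C by (simp add: risk_def adaptive_est_eq enn2ereal_le_ereal_iff)
qed

text \<open>On \<open>F2\<close> the directions of the bias bounds are reversed:
  \<open>\<delta>12\<close> is controlled from below and \<open>\<delta>21\<close> from above.
  Acceptance therefore confines \<open>\<delta>1\<close> from both sides, with \<open>q\<close> a
  common bound for all the moduli involved.\<close>

lemma adaptive_risk_F2:
  assumes n: "n \<ge> 1"
    and T: "linear_functional_on D T" "F1 \<union> F2 \<subseteq> D"
    and F: "convex_fun_set F1" "convex_fun_set F2" "F1 \<inter> F2 \<noteq> {}"
    and \<delta>2: "estimator \<delta>2"
    and w1: "omega1 T (noise n) F1 = ereal w1" "0 \<le> w1" "w1 \<le> q"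
    and g: "omega1 T (noise n) (F1 \<union> F2) = ereal g" "0 \<le> g" "g \<le> q"
    and q: "omega_plus T (log_radius n (gam_plus T n F1 F2)) F1 F2 \<le> ereal q"
    and \<delta>12: "bias_variance_estimator M W n T (sigma_sq T n F1 F1 F2) F1 F2 \<delta>12"
    and \<delta>21: "bias_variance_estimator M W n T (sigma_sq T n F1 F2 F1) F2 F1 \<delta>21"
    and f: "f \<in> F2" "f \<in> L2" and C: "0 \<le> C"
    and r2: "risk M W n 4 \<delta>2 f (T f) \<le> ereal (C * g ^ 4)"
  shows "risk M W n 2 (adaptive_est T n F1 F2 \<delta>1 \<delta>2 \<delta>12 \<delta>21) f (T f) \<le> ereal ((905 + C) * q\<^sup>2)"
proof -
  let ?o = "obs W n f"
  let ?A = "\<lambda>x. accept T n F1 F2 \<delta>1 \<delta>12 \<delta>21 (?o x)"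
  note [measurable] = measurable_estimator[OF \<delta>2, of n f]
  have q0: "0 \<le> q" using w1 by linarith
  have "C * g ^ 4 \<le> C * q ^ 4" using g C by (intro mult_left_mono power_mono) auto
  then have r2': "(\<integral>\<^sup>+x. ennreal ((\<delta>2 (?o x) - T f) ^ 4) \<partial>M) \<le> ennreal (C * q ^ 4)"
    using r2 C g by (auto simp: risk_def enn2ereal_le_ereal_iff intro: order_trans ennreal_leI)
  have le: "omega T (noise n) F1 F2 \<le> ereal g" "omega T (noise n) F2 F1 \<le> ereal g"
    unfolding g(1)[symmetric] by (auto intro!: omega_mono_sets)
  have w1': "0 \<le> omega1 T (noise n) F1" using w1 by simp
  have F': "F2 \<union> F1 \<subseteq> D" "F2 \<inter> F1 \<noteq> {}" using T F by auto
  have e: "ereal (exp 1) \<le> gam T n F1 Fi Fj" for Fi Fj by (simp add: gam_def)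
  \<comment> \<open>Both \<gamma>'s are at most \<gamma>_+, so their radii are no larger, and the
    ordered moduli are dominated by \<open>omega_plus\<close>.\<close>
  have w12q: "omega T (log_radius n (gam T n F1 F1 F2)) F1 F2 \<le> ereal q"
    by (rule order_trans[OF omega_mono order_trans[OF omega_le_omega_plus(1) q]])
      (rule log_radius_mono(2)[OF n e gam_le_gam_plus(1)[OF w1']])
  have w21q: "omega T (log_radius n (gam T n F1 F2 F1)) F2 F1 \<le> ereal q"
    by (rule order_trans[OF omega_mono order_trans[OF omega_le_omega_plus(2) q]])
      (rule log_radius_mono(2)[OF n e gam_le_gam_plus(2)[OF w1']])
  have lr: "0 \<le> log_radius n (gam T n F1 Fi Fj)" for Fi Fj
    by (rule order_trans[OF _ log_radius_mono(1)[OF n e order_refl]]) simp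
  obtain w where w: "omega T (log_radius n (gam T n F1 F1 F2)) F1 F2 = ereal w" "w \<le> q"
    using w12q omega_nonneg[OF F(3) lr, of T F1 F2]
    by (cases "omega T (log_radius n (gam T n F1 F1 F2)) F1 F2") auto
  obtain w' where w': "omega T (log_radius n (gam T n F1 F2 F1)) F2 F1 = ereal w'" "w' \<le> q"
    using w21q omega_nonneg[OF F'(2) lr, of T F2 F1]
    by (cases "omega T (log_radius n (gam T n F1 F2 F1)) F2 F1") auto
  obtain v where v: "sigma_sq T n F1 F1 F2 = ereal v" "v \<le> w\<^sup>2"
      "bias_bound T n (ereal v) F1 F2 \<le> ereal (w / 2)" "0 \<le> w"
    by (rule bias_variance_constants[OF n T F w1(1,2) _ w(1)]) (use le in auto)
  obtain v' where v': "sigma_sq T n F1 F2 F1 = ereal v'" "v' \<le> w'\<^sup>2"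
      "bias_bound T n (ereal v') F2 F1 \<le> ereal (w' / 2)" "0 \<le> w'"
    by (rule bias_variance_constants[OF n T(1) F'(1) F(2,1) F'(2) w1(1,2) _ w'(1)]) (use le in auto)
  note b = bias_variance_estimator_bounds[OF \<delta>12[unfolded v(1)] v(3,4) f(2)]
  note b' = bias_variance_estimator_bounds[OF \<delta>21[unfolded v'(1)] v'(3,4) f(2)]
  have sq: "w\<^sup>2 \<le> q\<^sup>2" "w'\<^sup>2 \<le> q\<^sup>2" using w w' v v' by (auto intro: power_mono)
  have A: "?A x \<longleftrightarrow> \<delta>12 (?o x) - 5 * (w1 + w) - 4 * g \<le> \<delta>1 (?o x) \<and>
      \<delta>1 (?o x) \<le> \<delta>21 (?o x) + 5 * (w1 + w') + 4 * g" for x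
    by (simp add: accept_def bdev_def w1 g w w')
  have "(\<integral>\<^sup>+x. ennreal (((if ?A x then \<delta>1 (?o x) else \<delta>2 (?o x)) - T f)\<^sup>2) \<partial>M) \<le> ennreal ((905 + C) * q\<^sup>2)"
  proof (rule selection_risk_sandwich[OF b(1) b'(1) _ _ _ _ _ _ _ r2' q0 C])
    show "variance (\<lambda>x. \<delta>12 (?o x)) \<le> q\<^sup>2" using b(2) v(2) sq by linarith
    show "variance (\<lambda>x. \<delta>21 (?o x)) \<le> q\<^sup>2" using b'(2) v'(2) sq by linarith
    show "T f - q \<le> expectation (\<lambda>x. \<delta>12 (?o x))" using b(4)[OF f(1)] w(2) by linarith
    show "expectation (\<lambda>x. \<delta>21 (?o x)) \<le> T f + q" using b'(3)[OF f(1)] w'(2) by linarith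
    show "\<delta>12 (?o x) - 14 * q \<le> \<delta>1 (?o x)" if "?A x" for x
      using that[unfolded A] w(2) w1(3) g(3) by argo
    show "\<delta>1 (?o x) \<le> \<delta>21 (?o x) + 14 * q" if "?A x" for x
      using that[unfolded A] w'(2) w1(3) g(3) by argo
  qed simp
  then show ?thesis
    using C by (simp add: risk_def adaptive_est_eq enn2ereal_le_ereal_iff)
qed

end

section \<open>Choice of a uniform constant and treatment of infinite moduli\<close>

theorem theorem3:
  fixes M :: "'w measure" and W :: "real \<Rightarrow> 'w \<Rightarrow> real"
    and F1 F2 D :: "(real \<Rightarrow> real) set" and T :: "(real \<Rightarrow> real) \<Rightarrow> real"
    and T1 T2 T12 T21 :: "nat \<Rightarrow> (real \<Rightarrow> real) \<Rightarrow> real" and C' :: real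
  assumes "brownian_motion M W"
    and "closed_L2 F1" and "convex_fun_set F1"
    and "closed_L2 F2" and "convex_fun_set F2"
    and "F1 \<inter> F2 \<noteq> {}"
    and "linear_functional_on D T" and "F1 \<union> F2 \<subseteq> D"
    and "\<And>\<epsilon>::real. \<epsilon> > 0 \<Longrightarrow> omega1 T (ereal \<epsilon>) F1 \<le> omega1 T (ereal \<epsilon>) F2"
    and "\<And>n. n \<ge> 1 \<Longrightarrow> linear_estimator M W n (T1 n)"
    and "\<And>n. n \<ge> 1 \<Longrightarrow>
           (SUP f\<in>F1. risk M W n 2 (T1 n) f (T f)) \<le> (omega1 T (noise n) F1)\<^sup>2"
    and "\<And>n. n \<ge> 1 \<Longrightarrow> estimator (T2 n)"
    and "\<And>n. n \<ge> 1 \<Longrightarrow>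
           (SUP f\<in>F1 \<union> F2. risk M W n 4 (T2 n) f (T f))
             \<le> ereal C' * (omega1 T (noise n) (F1 \<union> F2)) ^ 4"
    and "\<And>n. n \<ge> 1 \<Longrightarrow>
           bias_variance_estimator M W n T (sigma_sq T n F1 F1 F2) F1 F2 (T12 n)"
    and "\<And>n. n \<ge> 1 \<Longrightarrow>
           bias_variance_estimator M W n T (sigma_sq T n F1 F2 F1) F2 F1 (T21 n)"
  shows "\<exists>C::real. C > 0 \<and> (\<forall>n\<ge>1.
           (SUP f\<in>F1. risk M W n 2 (adaptive_est T n F1 F2 (T1 n) (T2 n) (T12 n) (T21 n)) f (T f))
             \<le> ereal C * (omega1 T (noise n) F1)\<^sup>2 \<and>
           (SUP f\<in>F2. risk M W n 2 (adaptive_est T n F1 F2 (T1 n) (T2 n) (T12 n) (T21 n)) f (T f))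
             \<le> ereal C * ((omega_plus T (log_radius n (gam_plus T n F1 F2)) F1 F2)\<^sup>2
                           + (omega1 T (noise n) F2)\<^sup>2))"
proof -
  interpret brownian_motion M W by (rule assms(1))
  \<comment> \<open>The sign of C' is not prescribed, so its positive part is taken. The constant
    905 + K from \<open>F2\<close> also covers 3 + K/2 from \<open>F1\<close>.\<close>
  define K where "K = max C' 0"
  define C where "C = 905 + K"
  have K: "0 \<le> K" "C' \<le> K" by (auto simp: K_def)
  have C: "1 \<le> C" "0 < C" using K by (auto simp: C_def)
  have L2: "F1 \<subseteq> L2" "F2 \<subseteq> L2" using assms(2,4) by (auto simp: closed_L2_def)
  have main: "(\<forall>f\<in>F1. risk M W n 2 (adaptive_est T n F1 F2 (T1 n) (T2 n) (T12 n) (T21 n)) f (T f)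
             \<le> ereal C * (omega1 T (noise n) F1)\<^sup>2) \<and>
           (\<forall>f\<in>F2. risk M W n 2 (adaptive_est T n F1 F2 (T1 n) (T2 n) (T12 n) (T21 n)) f (T f)
             \<le> ereal C * ((omega_plus T (log_radius n (gam_plus T n F1 F2)) F1 F2)\<^sup>2
                           + (omega1 T (noise n) F2)\<^sup>2))"
    (is "(\<forall>f\<in>F1. ?R f \<le> ereal C * ?w1\<^sup>2) \<and> (\<forall>f\<in>F2. ?R f \<le> ereal C * (?S\<^sup>2 + ?w2\<^sup>2))")
    if n: "n \<ge> 1" for n
  proof -
    let ?g = "omega1 T (noise n) (F1 \<union> F2)"
    have n0: "0 < 1 / sqrt (real n)" using n by simp
    have w12: "?w1 \<le> ?w2" by (rule assms(9)[OF n0])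
    have w1: "0 \<le> ?w1" using assms(6) by (intro omega_nonneg) auto
    have "?w1 \<le> ?g" by (intro omega_mono_sets) auto
    have g: "0 \<le> ?g" using \<open>?w1 \<le> ?g\<close> w1 by (rule order_trans[rotated])
    have S: "0 \<le> ?S"
    proof -
      have "noise n \<le> log_radius n (gam_plus T n F1 F2)"
        by (rule log_radius_mono(1)[OF n _ order_refl]) (simp add: gam_plus_def)
      then have "0 \<le> log_radius n (gam_plus T n F1 F2)" using n0 by (simp add: order_trans[rotated])
      from omega_nonneg[OF assms(6) this, of T] show ?thesis
        using omega_le_omega_plus(1) by (rule order_trans)
    qed
    \<comment> \<open>Of the three terms in \<open>omega_Un_le\<close>, the modulus of
      \<open>F1\<close> is absorbed by that of \<open>F2\<close>, and the mixed term grows when the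
      noise level is replaced by the logarithmic radius.\<close>
    have gS: "?g \<le> max ?w2 ?S"
    proof -
      have "omega_plus T (noise n) F1 F2 \<le> ?S"
        by (intro omega_plus_mono log_radius_mono(1)[OF n _ order_refl]) (simp add: gam_plus_def)
      then show ?thesis
        using omega_Un_le[of T "noise n" F1 F2] w12 by (auto simp: le_max_iff_disj)
    qed
    have r1: "risk M W n 2 (T1 n) f (T f) \<le> ?w1\<^sup>2" if "f \<in> F1" for f
      by (rule order_trans[OF SUP_upper[OF that] assms(11)[OF n]])
    have r2: "risk M W n 4 (T2 n) f (T f) \<le> ereal (K * g ^ 4)" if "f \<in> F1 \<union> F2" "?g = ereal g" for f g
    proof -
      have "risk M W n 4 (T2 n) f (T f) \<le> ereal (C' * g ^ 4)"
        using order_trans[OF SUP_upper[OF that(1)] assms(13)[OF n]] that(2) by simp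
      also have "\<dots> \<le> ereal (K * g ^ 4)" using K(2) by (simp add: mult_right_mono)
      finally show ?thesis .
    qed
    show ?thesis
    proof (intro conjI ballI)
      fix f assume f: "f \<in> F1"
      show "?R f \<le> ereal C * ?w1\<^sup>2"
      proof (cases ?w1)
        case w: (real w)
        have w0: "0 \<le> w" using w w1 by simp
        have r: "risk M W n 2 (T1 n) f (T f) \<le> ereal (w\<^sup>2)"
          using r1[OF f] w by simp
        show ?thesis
        proof (cases ?g)
          case g': (real g)
          have "?R f \<le> ereal ((3 + K / 2) * w\<^sup>2)"
            using f L2 g g' r2[OF _ g'] K(1)
            by (intro adaptive_risk_F1[OF n assms(7,8,3,5,6) assms(10,12)[OF n] w w0 g' _ assms(14,15)[OF n] _ _ K(1) r])
              auto
          also have "\<dots> \<le> ereal (C * w\<^sup>2)"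
            using K(1) by (simp add: C_def mult_right_mono)
          finally show ?thesis using w by simp
        next
          case PInf
          \<comment> \<open>With an infinite modulus on the union both constraints are void, so the
            estimator is \<open>T1\<close> itself. Nonnegativity of \<open>bdev\<close> excludes
            sums of opposite infinities in the bounds.\<close>
          have "0 \<le> bdev T n F1 Fi Fj" if "Fi \<inter> Fj \<noteq> {}" for Fi Fj
          proof -
            have "noise n \<le> log_radius n (gam T n F1 Fi Fj)"
              by (rule log_radius_mono(1)[OF n _ order_refl]) (simp add: gam_def)
            then have "0 \<le> log_radius n (gam T n F1 Fi Fj)" using n0 by (simp add: order_trans[rotated])
            from omega_nonneg[OF that this, of T] show ?thesis using w1 by (simp add: bdev_def)
          qed
          from this[of F1 F2] this[of F2 F1]
          have "accept T n F1 F2 (T1 n) (T12 n) (T21 n) y" for y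
            using assms(6) PInf unfolding accept_def
            by (cases "bdev T n F1 F1 F2"; cases "bdev T n F1 F2 F1") (auto simp: Int_commute)
          then have "?R f = risk M W n 2 (T1 n) f (T f)"
            by (simp add: risk_def adaptive_est_eq)
          also have "\<dots> \<le> ereal (C * w\<^sup>2)"
            using r C(1) mult_right_mono[of 1 C "w\<^sup>2"] by (intro order_trans[OF r]) simp
          finally show ?thesis using w by simp
        qed (use g in simp)
      qed (use C w1 in auto)
    next
      fix f assume f: "f \<in> F2"
      show "?R f \<le> ereal C * (?S\<^sup>2 + ?w2\<^sup>2)"
      proof (cases "?w2 = \<infinity> \<or> ?S = \<infinity>")
        case True
        then have "ereal C * (?S\<^sup>2 + ?w2\<^sup>2) = \<infinity>"
          using C S w1 w12 by auto
        then show ?thesis by (simp only: ereal_less_eq(1))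
      next
        case False
        then obtain s w2 where fin: "?S = ereal s" "?w2 = ereal w2" "0 \<le> s" "0 \<le> w2"
          using S order_trans[OF w1 w12] by (cases ?S; cases ?w2) auto
        obtain w where w: "?w1 = ereal w" "0 \<le> w" "w \<le> max s w2"
          using w1 w12 fin by (cases ?w1) auto
        obtain g' where g': "?g = ereal g'" "0 \<le> g'" "g' \<le> max s w2"
          using g gS fin by (cases ?g) (auto simp: max_def split: if_splits)
        \<comment> \<open>The larger of s and w2 serves as the common bound; its square is at most
          s^2 + w2^2.\<close>
        have "?R f \<le> ereal ((905 + K) * (max s w2)\<^sup>2)"
          using f L2 fin r2[OF _ g'(1)]
          by (intro adaptive_risk_F2[OF n assms(7,8,3,5,6) assms(12)[OF n] w g' _ assms(14,15)[OF n] _ _ K(1)])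
            auto
        also have "\<dots> \<le> ereal (C * (s\<^sup>2 + w2\<^sup>2))"
          using C by (auto simp: C_def max_def intro!: mult_left_mono)
        finally show ?thesis using fin by simp
      qed
    qed
  qed
  show ?thesis
    using C(2) main by (intro exI[of _ C] conjI allI impI SUP_least) blast+
qed

end
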